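(* Let $M\in[0,1]^{m\times n}$ with $\|M\|_*\le t$, let $\rho\in[0,1)$ and $\delta\in(0,1)$. Let $Y\in\{0,1\}^{m\times n}$ have independent entries with $P(Y_{ij}=1)=M_{ij}$, let $s$ be the number of ones in $Y$, and let $A\in\{0,1\}^{m\times n}$ be the observation matrix obtained by revealing each 1 of $Y$ independently with probability $1-\rho$ (so $P(A_{ij}=1)=M_{ij}(1-\rho)$, and $A_{ij}=0$ otherwise). Define $$\tilde{\ell}(x,a)=\begin{cases}\dfrac{(x-1)^2-\rho x^2}{1-\rho} & \text{if } a=1,\\[1mm] x^2 & \text{if } a=0,\end{cases}$$ and let $\hat{X}$ be a minimizer of $$\min_{X\in\mathbb{R}^{m\times n}}\sum_{i,j}\tilde{\ell}(X_{ij},A_{ij})\quad\text{subject to}\quad \|X\|_*\le t,\ 0\le X_{ij}\le 1\ \forall (i,j).$$ Then there is a constant $C$ such that, with probability at least $1-\delta$, $$\frac{1}{mn}\sum_{i,j}(M_{ij}-\hat{X}_{ij})^2\le 6\,\frac{\sqrt{\log(2/\delta)}}{\sqrt{mn}\,(1-\rho)}+2Ct\,\frac{\sqrt{n}+\sqrt{m}+\sqrt[4]{s}}{(1-\rho)mn}.$$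
   Context: $\|\cdot\|_*$ is the nuclear (trace) norm. The estimator $\hat{X}$ is the "shifted matrix completion" (ShiftMC) estimator for PU matrix completion in the non-deterministic setting, where only a fraction $1-\rho$ of the ones of the clean binary matrix $Y$ is observed. *)

theory Defs
  imports "Jordan_Normal_Form.Matrix" "HOL-Probability.Probability"
begin

definition mat_trace :: "real mat \<Rightarrow> real" where
  "mat_trace P = (\<Sum>i<dim_row P. P $$ (i, i))"

definition psd_mat :: "nat \<Rightarrow> real mat \<Rightarrow> bool" where
  "psd_mat n P \<longleftrightarrow> P \<in> carrier_mat n n \<and> transpose_mat P = P \<and>
     (\<forall>v \<in> carrier_vec n. 0 \<le> scalar_prod v (P *\<^sub>v v))"

(* nuclear (trace) norm: ||X||_* = tr sqrt(X^T X), i.e. the sum of the singular values *)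
definition nuclear_norm :: "real mat \<Rightarrow> real" where
  "nuclear_norm X = mat_trace (THE P. psd_mat (dim_col X) P \<and> P * P = transpose_mat X * X)"

definition entry_pmf :: "real \<Rightarrow> real \<Rightarrow> (bool \<times> bool) pmf" where
  "entry_pmf p \<rho> = do {
      y \<leftarrow> bernoulli_pmf p;
      a \<leftarrow> (if y then bernoulli_pmf (1 - \<rho>) else return_pmf False);
      return_pmf (y, a) }"

definition obs_pmf :: "nat \<Rightarrow> nat \<Rightarrow> real mat \<Rightarrow> real \<Rightarrow> (nat \<times> nat \<Rightarrow> bool \<times> bool) pmf" where
  "obs_pmf m n M \<rho> = Pi_pmf ({..<m} \<times> {..<n}) (False, False) (\<lambda>(i, j). entry_pmf (M $$ (i, j)) \<rho>)"

definition shifted_loss :: "real \<Rightarrow> real \<Rightarrow> bool \<Rightarrow> real" where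
  "shifted_loss \<rho> x a = (if a then ((x - 1)\<^sup>2 - \<rho> * x\<^sup>2) / (1 - \<rho>) else x\<^sup>2)"

definition shiftmc_objective :: "nat \<Rightarrow> nat \<Rightarrow> real \<Rightarrow> (nat \<times> nat \<Rightarrow> bool) \<Rightarrow> real mat \<Rightarrow> real" where
  "shiftmc_objective m n \<rho> A X = (\<Sum>i<m. \<Sum>j<n. shifted_loss \<rho> (X $$ (i, j)) (A (i, j)))"

definition shiftmc_feasible :: "nat \<Rightarrow> nat \<Rightarrow> real \<Rightarrow> real mat \<Rightarrow> bool" where
  "shiftmc_feasible m n t X \<longleftrightarrow> X \<in> carrier_mat m n \<and> nuclear_norm X \<le> t \<and>
     (\<forall>i<m. \<forall>j<n. 0 \<le> X $$ (i, j) \<and> X $$ (i, j) \<le> 1)"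

definition shiftmc_minimizer :: "nat \<Rightarrow> nat \<Rightarrow> real \<Rightarrow> real \<Rightarrow> (nat \<times> nat \<Rightarrow> bool) \<Rightarrow> real mat \<Rightarrow> bool" where
  "shiftmc_minimizer m n t \<rho> A X \<longleftrightarrow> shiftmc_feasible m n t X \<and>
     (\<forall>X'. shiftmc_feasible m n t X' \<longrightarrow> shiftmc_objective m n \<rho> A X \<le> shiftmc_objective m n \<rho> A X')"

end

theory Submission
  imports Defs
begin

text \<open>
  Up to a term depending only on \<open>A\<close>, the objective is \<open>\<parallel>X - A / (1 - \<rho>)\<parallel>\<^sup>2\<close> in the Frobenius norm, and
  \<open>A / (1 - \<rho>)\<close> has mean \<open>M\<close>. Comparing the minimizer with the feasible point \<open>M\<close> gives
  \<open>\<parallel>X - M\<parallel>\<^sup>2 \<le> 2 / (1 - \<rho>) * \<langle>X - M, W\<rangle>\<close> with the centred noise \<open>W = A - (1 - \<rho>) M\<close>. The supremum of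
  \<open>\<langle>X - M, W\<rangle>\<close> over all feasible \<open>X\<close> changes by at most 1 when one entry of \<open>A\<close> changes, so by McDiarmid's
  inequality it exceeds its mean by \<open>sqrt (m n ln (2 / \<delta>))\<close> with probability at most \<open>\<delta>\<close>. By duality of the
  nuclear and the operator norm, its mean is at most \<open>2 t\<close> times the mean operator norm of \<open>W\<close>, which is
  \<open>O(sqrt m + sqrt n)\<close>: the operator norm is dominated by a maximum of \<open>exp (6 (m + n))\<close> subgaussian
  bilinear forms.
\<close>

section \<open>Spectral theorem for real symmetric matrices\<close>

text \<open>Vectors are functions on \<open>nat\<close> of which only the coordinates below
  \<open>n\<close> are read. Families of vectors are then plain functions, and limits of vectors
  live in a product space, without carrier conditions.\<close>

definition ip :: "nat \<Rightarrow> (nat \<Rightarrow> real) \<Rightarrow> (nat \<Rightarrow> real) \<Rightarrow> real" where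
  "ip n x y = (\<Sum>i<n. x i * y i)"

definition lin :: "nat \<Rightarrow> (nat \<Rightarrow> nat \<Rightarrow> real) \<Rightarrow> (nat \<Rightarrow> real) \<Rightarrow> nat \<Rightarrow> real" where
  "lin n S v i = (\<Sum>j<n. S i j * v j)"

definition orthonormal :: "nat \<Rightarrow> nat \<Rightarrow> (nat \<Rightarrow> nat \<Rightarrow> real) \<Rightarrow> bool" where
  "orthonormal n K e \<longleftrightarrow> (\<forall>k<K. \<forall>l<K. ip n (e k) (e l) = of_bool (k = l))"

section \<open>Bilinear algebra of \<open>ip\<close> and \<open>lin\<close>\<close>

lemma ip_commute: "ip n x y = ip n y x"
  by (simp add: ip_def mult.commute)

lemma ip_add_left: "ip n (\<lambda>i. x i + y i) z = ip n x z + ip n y z"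
  by (simp add: ip_def algebra_simps sum.distrib)

lemma ip_diff_left: "ip n (\<lambda>i. x i - y i) z = ip n x z - ip n y z"
  by (simp add: ip_def algebra_simps sum_subtractf)

lemma ip_scale_left: "ip n (\<lambda>i. c * x i) z = c * ip n x z"
  by (simp add: ip_def algebra_simps sum_distrib_left)

lemma ip_sum_left: "ip n (\<lambda>i. \<Sum>k\<in>A. x k i) z = (\<Sum>k\<in>A. ip n (x k) z)"
  unfolding ip_def sum_distrib_right by (rule sum.swap)

lemma ip_nonneg: "0 \<le> ip n x x"
  by (simp add: ip_def sum_nonneg)

lemma ip_eq_0_iff: "ip n x x = 0 \<longleftrightarrow> (\<forall>i<n. x i = 0)"
  unfolding ip_def by (subst sum_nonneg_eq_0_iff) auto

lemma ip_delta: "j < n \<Longrightarrow> ip n (\<lambda>i. of_bool (i = j)) z = z j"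
  by (simp add: ip_def of_bool_def if_distrib[of "\<lambda>x. x * _"] cong: if_cong)

lemma ip_cong: "(\<And>i. i < n \<Longrightarrow> x i = x' i) \<Longrightarrow> (\<And>i. i < n \<Longrightarrow> y i = y' i) \<Longrightarrow> ip n x y = ip n x' y'"
  by (simp add: ip_def)

lemma ip_lin_right: "ip m u (lin n S v) = (\<Sum>i<m. \<Sum>j<n. u i * S i j * v j)"
  by (simp add: ip_def lin_def sum_distrib_left mult.assoc)

lemma ip_lin_transpose: "ip m u (lin n S v) = ip n (lin m (\<lambda>i j. S j i) u) v"
  unfolding ip_lin_right unfolding ip_def lin_def sum_distrib_right
  by (subst sum.swap) (simp add: mult_ac)

lemma ip_lin_symmetric:
  assumes "\<And>i j. i < n \<Longrightarrow> j < n \<Longrightarrow> S i j = S j i"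
  shows "ip n u (lin n S v) = ip n (lin n S u) v"
proof -
  have "ip n (lin n (\<lambda>i j. S j i) u) v = ip n (lin n S u) v"
    by (intro ip_cong) (auto simp: lin_def assms intro!: sum.cong)
  then show ?thesis by (simp add: ip_lin_transpose)
qed

text \<open>\<open>r\<close> is the \<open>j\<close>-th unit vector minus its projection onto the
  span of the family. Being orthogonal to the family, it has squared norm equal to its pairing with
  that unit vector, which is its own coordinate \<open>r j\<close>.\<close>

lemma orthonormal_residual:
  fixes e n K j
  defines "r \<equiv> \<lambda>i. of_bool (i = j) - (\<Sum>k<K. e k j * e k i)"
  assumes e: "orthonormal n K e" and j: "j < n"
  shows "l < K \<Longrightarrow> ip n r (e l) = 0" "ip n r r = 1 - (\<Sum>k<K. (e k j)\<^sup>2)"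
proof -
  have *: "ip n r (e l) = 0" if "l < K" for l
  proof -
    have "ip n r (e l) = e l j - (\<Sum>k<K. e k j * ip n (e k) (e l))"
      unfolding r_def by (simp add: ip_diff_left ip_delta j ip_sum_left ip_scale_left)
    also have "(\<Sum>k<K. e k j * ip n (e k) (e l)) = (\<Sum>k<K. if k = l then e k j else 0)"
      by (rule sum.cong) (use e that in \<open>auto simp: orthonormal_def\<close>)
    finally show ?thesis using that by simp
  qed
  then show "l < K \<Longrightarrow> ip n r (e l) = 0" .
  have "ip n r r = ip n (\<lambda>i. of_bool (i = j)) r - (\<Sum>k<K. e k j * ip n (e k) r)"
    by (subst r_def) (simp add: ip_diff_left ip_sum_left ip_scale_left)
  also have "\<dots> = r j" by (simp add: ip_delta j * ip_commute[of n "e _" r])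
  finally show "ip n r r = 1 - (\<Sum>k<K. (e k j)\<^sup>2)" by (simp add: r_def power2_eq_square)
qed

text \<open>Stands in for dimension theory: the double sum is the trace of the projection onto the
  span, and summing over coordinates first turns it into \<open>K\<close> unit norms.\<close>

lemma orthonormal_sum_squares:
  assumes "orthonormal n K e"
  shows "(\<Sum>j<n. \<Sum>k<K. (e k j)\<^sup>2) = real K"
proof -
  have "(\<Sum>j<n. \<Sum>k<K. (e k j)\<^sup>2) = (\<Sum>k<K. ip n (e k) (e k))"
    unfolding ip_def by (subst sum.swap) (simp add: power2_eq_square)
  also have "\<dots> = real K" using assms by (simp add: orthonormal_def)
  finally show ?thesis .
qed

lemma ip_normalize:
  assumes "0 < ip n r r"
  shows "ip n (\<lambda>i. (1 / sqrt (ip n r r)) * r i) (\<lambda>i. (1 / sqrt (ip n r r)) * r i) = 1"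
  using assms by (subst ip_scale_left, subst ip_commute, subst ip_scale_left) simp

text \<open>The residuals of the coordinate vectors have squared norms adding up to \<open>n - K > 0\<close>, so one of
  them does not vanish.\<close>

lemma orthonormal_extend:
  assumes e: "orthonormal n K e" and "K < n"
  obtains v where "ip n v v = 1" "\<And>l. l < K \<Longrightarrow> ip n v (e l) = 0"
proof -
  have "\<exists>j<n. (\<Sum>k<K. (e k j)\<^sup>2) < 1"
  proof (rule ccontr)
    assume "\<not> ?thesis"
    then have "(\<Sum>j<n. 1) \<le> (\<Sum>j<n. \<Sum>k<K. (e k j)\<^sup>2)" by (intro sum_mono) force
    then show False using orthonormal_sum_squares[OF e] \<open>K < n\<close> by simp
  qed
  then obtain j where j: "j < n" "(\<Sum>k<K. (e k j)\<^sup>2) < 1" by blast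
  define r where "r = (\<lambda>i. of_bool (i = j) - (\<Sum>k<K. e k j * e k i))"
  note res = orthonormal_residual[OF e j(1), folded r_def]
  have "0 < ip n r r" using res(2) j(2) by simp
  from ip_normalize[OF this] show thesis
    by (rule that) (subst ip_scale_left, simp add: res(1))
qed

text \<open>Each unit vector has a residual of nonnegative squared norm, and for \<open>n\<close>
  orthonormal vectors these squared norms add up to \<open>n - n = 0\<close>. So every residual
  vanishes, coordinate by coordinate.\<close>

lemma orthonormal_complete:
  assumes e: "orthonormal n n e" and "i < n" "j < n"
  shows "(\<Sum>k<n. e k j * e k i) = of_bool (i = j)"
proof -
  have le: "(\<Sum>k<n. (e k j)\<^sup>2) \<le> 1" if "j < n" for j
    using orthonormal_residual(2)[OF e that] ip_nonneg[of n "\<lambda>i. of_bool (i = j) - (\<Sum>k<n. e k j * e k i)"]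
    by linarith
  have "(\<Sum>j<n. 1 - (\<Sum>k<n. (e k j)\<^sup>2)) = 0"
    by (simp add: sum_subtractf orthonormal_sum_squares[OF e])
  then have "\<forall>j\<in>{..<n}. 1 - (\<Sum>k<n. (e k j)\<^sup>2) = 0"
    using le by (subst sum_nonneg_eq_0_iff[symmetric]) auto
  then have "1 - (\<Sum>k<n. (e k j)\<^sup>2) = 0" using \<open>j < n\<close> by blast
  then have "ip n (\<lambda>i. of_bool (i = j) - (\<Sum>k<n. e k j * e k i)) (\<lambda>i. of_bool (i = j) - (\<Sum>k<n. e k j * e k i)) = 0"
    using orthonormal_residual(2)[OF e \<open>j < n\<close>] by linarith
  then have "of_bool (i = j) - (\<Sum>k<n. e k j * e k i) = 0"
    using \<open>i < n\<close> by (simp only: ip_eq_0_iff)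
  then show ?thesis by simp
qed

text \<open>A continuous function attains its maximum on the compact set of unit vectors orthogonal
  to the family; homogeneity carries the bound over to vectors of any length.\<close>

lemma rayleigh_maximum:
  assumes e: "orthonormal n K e" and "K < n"
  obtains v where "ip n v v = 1" "\<And>l. l < K \<Longrightarrow> ip n v (e l) = 0"
    "\<And>w. (\<And>l. l < K \<Longrightarrow> ip n w (e l) = 0) \<Longrightarrow> ip n w (lin n S w) \<le> ip n v (lin n S v) * ip n w w"
proof -
  \<comment> \<open>Coordinates from \<open>n\<close> on are pinned to 0 and the others confined to
    a compact interval, so the box is compact by Tychonoff's theorem, although the functions have
    infinitely many coordinates.\<close>
  define U where "U = PiE UNIV (\<lambda>i. if i < n then {-1..1::real} else {0}) \<inter>
    ({v. ip n v v = 1} \<inter> (\<Inter>l\<in>{..<K}. {v. ip n v (e l) = 0}))"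
  have "compactin (product_topology (\<lambda>_::nat. euclidean) UNIV)
      (PiE UNIV (\<lambda>i. if i < n then {-1..1::real} else {0}))"
    by (subst compactin_PiE) auto
  then have 1: "compact (PiE UNIV (\<lambda>i. if i < n then {-1..1::real} else {0}))"
    by (simp add: euclidean_product_topology)
  have "compact U" unfolding U_def
    by (intro compact_Int_closed[OF 1] closed_Int closed_INT ballI closed_Collect_eq)
      (auto simp: ip_def intro!: continuous_intros)
  \<comment> \<open>Pinning loses nothing: every admissible unit vector agrees below
    \<open>n\<close> with an element of \<open>U\<close>.\<close>
  have embed: "\<exists>v'\<in>U. \<forall>i<n. v' i = v i" if "ip n v v = 1" "\<And>l. l < K \<Longrightarrow> ip n v (e l) = 0" for v
  proof (intro bexI)
    let ?v = "\<lambda>i. if i < n then v i else 0"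
    have "\<bar>v i\<bar> \<le> 1" if "i < n" for i
    proof -
      have "(v i)\<^sup>2 \<le> ip n v v" unfolding ip_def power2_eq_square
        by (rule member_le_sum) (use \<open>i < n\<close> in auto)
      then show ?thesis using \<open>ip n v v = 1\<close> by (simp add: abs_square_le_1)
    qed
    then have "?v \<in> PiE UNIV (\<lambda>i. if i < n then {-1..1} else {0})"
      by (auto simp: abs_le_iff minus_le_iff)
    moreover have "ip n ?v w = ip n v w" for w by (rule ip_cong) auto
    then have "ip n ?v ?v = 1" "\<And>l. l < K \<Longrightarrow> ip n ?v (e l) = 0"
      using that by (simp_all add: ip_commute[of n v ?v])
    ultimately show "?v \<in> U" unfolding U_def by blast
  qed auto
  obtain v0 where "ip n v0 v0 = 1" "\<And>l. l < K \<Longrightarrow> ip n v0 (e l) = 0"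
    using orthonormal_extend[OF assms] by blast
  with embed have "U \<noteq> {}" by blast
  moreover have "continuous_on U (\<lambda>v. ip n v (lin n S v))"
    unfolding ip_lin_right
    by (intro continuous_intros continuous_on_subset[OF continuous_on_product_coordinates]) auto
  ultimately have "\<exists>v\<in>U. \<forall>w\<in>U. ip n w (lin n S w) \<le> ip n v (lin n S v)"
    by (intro continuous_attains_sup[OF \<open>compact U\<close>])
  then obtain v where v: "v \<in> U" "\<And>w. w \<in> U \<Longrightarrow> ip n w (lin n S w) \<le> ip n v (lin n S v)"
    by blast
  show thesis
  proof (rule that)
    show "ip n v v = 1" "\<And>l. l < K \<Longrightarrow> ip n v (e l) = 0" using v(1) by (auto simp: U_def)
    fix w assume w: "\<And>l. l < K \<Longrightarrow> ip n w (e l) = 0"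
    show "ip n w (lin n S w) \<le> ip n v (lin n S v) * ip n w w"
    proof (cases "ip n w w = 0")
      case True
      then have "ip n w (lin n S w) = 0" unfolding ip_lin_right by (simp add: ip_eq_0_iff)
      then show ?thesis using True by simp
    next
      case False
      then have pos: "0 < ip n w w" using ip_nonneg[of n w] by linarith
      \<comment> \<open>Both sides are quadratic in \<open>w\<close>, so it suffices to compare at
        the normalized vector.\<close>
      define c where "c = 1 / sqrt (ip n w w)"
      have "ip n (\<lambda>i. c * w i) (e l) = 0" if "l < K" for l
        using w[OF that] by (simp add: ip_scale_left)
      with ip_normalize[OF pos] embed obtain w' where w': "w' \<in> U" "\<And>i. i < n \<Longrightarrow> w' i = c * w i"
        unfolding c_def by blast
      have "ip n w' (lin n S w') = c\<^sup>2 * ip n w (lin n S w)"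
        unfolding ip_lin_right by (simp add: w'(2) power2_eq_square sum_distrib_left mult_ac)
      with v(2)[OF w'(1)] have "c\<^sup>2 * ip n w (lin n S w) \<le> ip n v (lin n S v)" by simp
      moreover have "c\<^sup>2 = 1 / ip n w w" using pos by (simp add: c_def power_divide)
      ultimately show ?thesis using pos by (simp add: field_simps)
    qed
  qed
qed

text \<open>After division by \<open>x\<close>, small \<open>x\<close> lets the first-order term
  win. If \<open>a > 0\<close>, the explicit choice of \<open>x\<close> below keeps the second-order
  term at most \<open>a\<close> in absolute value, against the first-order term
  \<open>2 * a\<close>.\<close>

lemma nonpos_if_perturbation_nonpos:
  fixes a b :: real
  assumes "\<And>x. 0 < x \<Longrightarrow> 2 * x * a + x\<^sup>2 * b \<le> 0"
  shows "a \<le> 0"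
proof (rule ccontr)
  assume "\<not> a \<le> 0"
  define x where "x = a / (\<bar>b\<bar> + 1)"
  have x: "0 < x" "x * \<bar>b\<bar> \<le> a" using \<open>\<not> a \<le> 0\<close> by (auto simp: x_def field_simps)
  have "x * (2 * a + x * b) \<le> 0" using assms[OF x(1)] by (simp add: algebra_simps power2_eq_square)
  then have "2 * a + x * b \<le> 0" using x(1) by (simp add: mult_le_0_iff)
  moreover have "- (x * \<bar>b\<bar>) \<le> x * b" using x(1) by (cases "b \<ge> 0") auto
  ultimately show False using x \<open>\<not> a \<le> 0\<close> by linarith
qed

lemma lin_add: "lin n S (\<lambda>i. x i + c * y i) i = lin n S x i + c * lin n S y i"
  by (simp add: lin_def algebra_simps sum.distrib sum_distrib_left)

text \<open>A maximizer of the Rayleigh quotient on the orthogonal complement is an eigenvector.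
  Symmetry of \<open>S\<close> makes the complement invariant, so the residual \<open>r\<close> of
  the eigenvector equation stays in it; moving \<open>v\<close> along \<open>r\<close> changes the
  quadratic form to first order by twice \<open>ip n r r\<close>.\<close>

lemma spectral_step:
  assumes sym: "\<And>i j. i < n \<Longrightarrow> j < n \<Longrightarrow> S i j = S j i"
    and e: "orthonormal n K e" and "K < n"
    and ev: "\<And>k i. k < K \<Longrightarrow> i < n \<Longrightarrow> lin n S (e k) i = lam k * e k i"
  obtains v \<mu> where "ip n v v = 1" "\<And>l. l < K \<Longrightarrow> ip n v (e l) = 0"
    "\<And>i. i < n \<Longrightarrow> lin n S v i = \<mu> * v i"
proof -
  obtain v where v: "ip n v v = 1" "\<And>l. l < K \<Longrightarrow> ip n v (e l) = 0"
    and max: "\<And>w. (\<And>l. l < K \<Longrightarrow> ip n w (e l) = 0) \<Longrightarrow> ip n w (lin n S w) \<le> ip n v (lin n S v) * ip n w w"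
    using rayleigh_maximum[OF e \<open>K < n\<close>] by metis
  define \<mu> where "\<mu> = ip n v (lin n S v)"
  define r where "r = (\<lambda>i. lin n S v i - \<mu> * v i)"
  have re: "ip n r (e l) = 0" if "l < K" for l
  proof -
    have "ip n (lin n S v) (e l) = ip n v (lin n S (e l))"
      by (rule ip_lin_symmetric[symmetric]) (rule sym)
    also have "\<dots> = ip n v (\<lambda>i. lam l * e l i)" by (intro ip_cong) (auto simp: ev that)
    also have "\<dots> = 0" using v(2)[OF that] by (subst ip_commute) (simp add: ip_scale_left ip_commute)
    finally show ?thesis unfolding r_def by (simp add: ip_diff_left ip_scale_left v(2) that)
  qed
  have rv: "ip n r v = 0" unfolding r_def
    by (simp add: ip_diff_left ip_scale_left v(1) \<mu>_def ip_commute)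
  have Svr: "ip n (lin n S v) r = ip n r r"
    using rv by (subst (2) r_def) (simp add: ip_diff_left ip_scale_left ip_commute)
  \<comment> \<open>The gradient \<open>r\<close> of the Rayleigh quotient is an admissible direction, so it must vanish at the maximum.\<close>
  have "ip n r r \<le> 0"
  proof (rule nonpos_if_perturbation_nonpos)
    fix x :: real assume "0 < x"
    define w where "w = (\<lambda>i. v i + x * r i)"
    have "ip n w (e l) = 0" if "l < K" for l
      unfolding w_def by (simp add: ip_add_left ip_scale_left v re that)
    then have "ip n w (lin n S w) \<le> \<mu> * ip n w w" unfolding \<mu>_def by (rule max)
    moreover have "ip n w w = 1 + x\<^sup>2 * ip n r r"
    proof -
      have 1: "ip n w z = ip n v z + x * ip n r z" for z
        unfolding w_def by (simp add: ip_add_left ip_scale_left)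
      have "ip n v w = 1" "ip n r w = x * ip n r r"
        using v(1) rv 1[of v] 1[of r] by (simp_all add: ip_commute[of n v w] ip_commute[of n r w] ip_commute[of n v r])
      then show ?thesis using 1[of w] by (simp add: power2_eq_square)
    qed
    moreover have "ip n w (lin n S w) = \<mu> + 2 * x * ip n r r + x\<^sup>2 * ip n r (lin n S r)"
    proof -
      have 1: "ip n w z = ip n v z + x * ip n r z" for z
        unfolding w_def by (simp add: ip_add_left ip_scale_left)
      have 2: "ip n z (lin n S w) = ip n z (lin n S v) + x * ip n z (lin n S r)" for z
      proof -
        have "lin n S w = (\<lambda>i. lin n S v i + x * lin n S r i)" unfolding w_def by (rule ext) (rule lin_add)
        then show ?thesis by (simp add: ip_commute[of n z] ip_add_left ip_scale_left)
      qed
      have 3: "ip n v (lin n S r) = ip n r r"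
        using Svr ip_lin_symmetric[of n S v r, OF sym] by simp
      have 4: "ip n r (lin n S v) = ip n r r" using Svr by (simp add: ip_commute)
      show ?thesis by (simp add: 1 2 3 4 \<mu>_def[symmetric] power2_eq_square algebra_simps)
    qed
    ultimately show "2 * x * ip n r r + x\<^sup>2 * (ip n r (lin n S r) - \<mu> * ip n r r) \<le> 0"
      by (simp add: algebra_simps)
  qed
  then have "ip n r r = 0" using ip_nonneg[of n r] by linarith
  then have "lin n S v i = \<mu> * v i" if "i < n" for i using that by (simp add: ip_eq_0_iff r_def)
  with v show thesis by (rule that)
qed

lemma symmetric_spectral:
  assumes sym: "\<And>i j. i < n \<Longrightarrow> j < n \<Longrightarrow> S i j = S j i"
  obtains e lam where "orthonormal n n e"
    "\<And>k i. k < n \<Longrightarrow> i < n \<Longrightarrow> lin n S (e k) i = lam k * e k i"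
proof -
  have "\<exists>e lam. orthonormal n K e \<and> (\<forall>k<K. \<forall>i<n. lin n S (e k) i = lam k * e k i)" if "K \<le> n" for K
    using that
  proof (induction K)
    case 0
    then show ?case by (simp add: orthonormal_def)
  next
    case (Suc K)
    then obtain e lam where e: "orthonormal n K e"
      and ev: "\<And>k i. k < K \<Longrightarrow> i < n \<Longrightarrow> lin n S (e k) i = lam k * e k i" by auto
    obtain v \<mu> where v: "ip n v v = 1" "\<And>l. l < K \<Longrightarrow> ip n v (e l) = 0"
      "\<And>i. i < n \<Longrightarrow> lin n S v i = \<mu> * v i"
      using spectral_step[of n S K e lam, OF sym e _ ev] Suc.prems by (metis Suc_le_lessD)
    have "orthonormal n (Suc K) (e(K := v))"
      using e v unfolding orthonormal_def by (auto simp: less_Suc_eq ip_commute)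
    moreover have "\<forall>k<Suc K. \<forall>i<n. lin n S ((e(K := v)) k) i = (lam(K := \<mu>)) k * (e(K := v)) k i"
      using ev v by (auto simp: less_Suc_eq)
    ultimately show ?case by blast
  qed
  then show thesis using that by blast
qed

section \<open>Duality for the nuclear norm\<close>

lemma lin_lin: "lin n (\<lambda>i j. \<Sum>l<n. A i l * B l j) v i = lin n A (lin n B v) i"
  unfolding lin_def sum_distrib_left sum_distrib_right
  by (subst sum.swap) (simp add: mult_ac)

lemma lin_cong:
  "(\<And>j. j < n \<Longrightarrow> S i j = S' i j) \<Longrightarrow> (\<And>j. j < n \<Longrightarrow> v j = v' j) \<Longrightarrow> lin n S v i = lin n S' v' i"
  by (simp add: lin_def)

text \<open>A matrix is determined by its action on an orthonormal eigenbasis: insert the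
  completeness relation into row \<open>i\<close>. This is the way matrix identities are proved
  below, entry by entry.\<close>

lemma eigenbasis_expansion:
  assumes e: "orthonormal n n e" and "\<And>k. k < n \<Longrightarrow> lin n T (e k) i = \<mu> k * e k i"
    and "i < n" "j < n"
  shows "T i j = (\<Sum>k<n. \<mu> k * e k i * e k j)"
proof -
  have "T i j = (\<Sum>l<n. T i l * of_bool (l = j))"
    using \<open>j < n\<close> by (simp add: of_bool_def if_distrib[of "\<lambda>x. _ * x"] cong: if_cong)
  also have "\<dots> = (\<Sum>l<n. T i l * (\<Sum>k<n. e k j * e k l))"
    by (intro sum.cong) (simp_all add: orthonormal_complete[OF e _ \<open>j < n\<close>])
  also have "\<dots> = (\<Sum>k<n. e k j * lin n T (e k) i)"
    unfolding lin_def sum_distrib_left by (subst sum.swap) (simp add: mult_ac)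
  also have "\<dots> = (\<Sum>k<n. \<mu> k * e k i * e k j)"
    by (intro sum.cong) (simp_all add: assms(2) mult_ac)
  finally show ?thesis .
qed

text \<open>Factor \<open>q^2 - s^2 = (q + s) (q - s)\<close>: the vector
  \<open>w = (q - s) v\<close> satisfies \<open>q w = - s w\<close>, which positivity forbids for
  \<open>s > 0\<close> unless \<open>w = 0\<close>. For \<open>s = 0\<close>, symmetry gives that
  the squared norm of \<open>q v\<close> is the pairing of \<open>q (q v) = 0\<close> with
  \<open>v\<close>. This yields uniqueness of the square root.\<close>

lemma psd_sqrt_eigenvector:
  assumes sym: "\<And>i j. i < n \<Longrightarrow> j < n \<Longrightarrow> q i j = q j i"
    and psd: "\<And>v. 0 \<le> ip n v (lin n q v)" and "0 \<le> s"
    and ev: "\<And>i. i < n \<Longrightarrow> lin n q (lin n q v) i = s\<^sup>2 * v i" and "i < n"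
  shows "lin n q v i = s * v i"
proof -
  define w where "w = (\<lambda>i. lin n q v i + - s * v i)"
  have "ip n w w = 0"
  proof (cases "s = 0")
    case True
    then have w: "w = lin n q v" by (simp add: w_def)
    have "ip n w w = ip n (lin n q (lin n q v)) v"
      unfolding w by (rule ip_lin_symmetric) (rule sym)
    also have "\<dots> = ip n (\<lambda>i. 0 * v i) v" by (rule ip_cong) (simp_all add: ev True)
    also have "\<dots> = 0" by (subst ip_scale_left) simp
    finally show ?thesis .
  next
    case False
    have "lin n q w i = - s * w i" if "i < n" for i
      unfolding w_def by (subst lin_add) (simp add: ev that power2_eq_square algebra_simps)
    then have "ip n w (lin n q w) = ip n w (\<lambda>i. - s * w i)" by (intro ip_cong) auto
    also have "\<dots> = - s * ip n w w" by (subst ip_commute, subst ip_scale_left) simp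
    finally have "s * ip n w w \<le> 0" using psd[of w] by simp
    then have "ip n w w \<le> 0" using False \<open>0 \<le> s\<close> by (simp add: mult_le_0_iff)
    then show ?thesis using ip_nonneg[of n w] by linarith
  qed
  then have "w i = 0" using \<open>i < n\<close> by (simp only: ip_eq_0_iff)
  then show ?thesis by (simp add: w_def)
qed

section \<open>From matrices to coordinate functions\<close>

lemma quadratic_form_mat:
  assumes "Q \<in> carrier_mat n n"
  shows "scalar_prod (Matrix.vec n v) (Q *\<^sub>v Matrix.vec n v) = ip n v (lin n (\<lambda>i j. Q $$ (i, j)) v)"
  using assms by (auto simp: scalar_prod_def ip_def lin_def lessThan_atLeast0 intro!: sum.cong)

lemma psd_matD:
  assumes "psd_mat n Q"
  shows "Q \<in> carrier_mat n n" "i < n \<Longrightarrow> j < n \<Longrightarrow> Q $$ (i, j) = Q $$ (j, i)"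
    "0 \<le> ip n v (lin n (\<lambda>i j. Q $$ (i, j)) v)"
proof -
  show Q: "Q \<in> carrier_mat n n" using assms by (simp add: psd_mat_def)
  show "Q $$ (i, j) = Q $$ (j, i)" if "i < n" "j < n"
  proof -
    have "transpose_mat Q $$ (j, i) = Q $$ (i, j)" using Q that by simp
    then show ?thesis using assms by (simp add: psd_mat_def)
  qed
  have "0 \<le> scalar_prod (Matrix.vec n v) (Q *\<^sub>v Matrix.vec n v)" using assms unfolding psd_mat_def by auto
  then show "0 \<le> ip n v (lin n (\<lambda>i j. Q $$ (i, j)) v)" by (simp add: quadratic_form_mat[OF Q])
qed

lemma gram_quadratic_form:
  "ip n v (lin n (\<lambda>i j. \<Sum>a<m. X a i * X a j) v) = ip m (lin n X v) (lin n X v)"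
proof -
  have "ip n v (lin n (\<lambda>i j. \<Sum>a<m. X a i * X a j) v) = (\<Sum>i<n. \<Sum>j<n. \<Sum>a<m. v i * X a i * (X a j * v j))"
    unfolding ip_lin_right sum_distrib_left sum_distrib_right by (simp add: mult_ac)
  also have "\<dots> = (\<Sum>i<n. \<Sum>a<m. \<Sum>j<n. v i * X a i * (X a j * v j))"
    by (intro sum.cong refl sum.swap)
  also have "\<dots> = (\<Sum>a<m. \<Sum>i<n. \<Sum>j<n. v i * X a i * (X a j * v j))" by (rule sum.swap)
  also have "\<dots> = ip m (lin n X v) (lin n X v)"
    unfolding ip_def lin_def by (intro sum.cong refl) (simp add: sum_product mult_ac)
  finally show ?thesis .
qed

text \<open>\<open>nuclear_norm\<close> is defined by a definite description, so both existence and uniqueness of the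
  positive semidefinite square root are needed to evaluate it.\<close>

lemma nuclear_norm_svd:
  fixes X :: "real mat"
  assumes X: "X \<in> carrier_mat m n"
  obtains e s where "orthonormal n n e" "\<And>k. k < n \<Longrightarrow> 0 \<le> s k"
    "\<And>k. k < n \<Longrightarrow> ip m (lin n (\<lambda>a i. X $$ (a, i)) (e k)) (lin n (\<lambda>a i. X $$ (a, i)) (e k)) = (s k)\<^sup>2"
    "nuclear_norm X = (\<Sum>k<n. s k)"
proof -
  define x where "x = (\<lambda>a i. X $$ (a, i))"
  define S where "S = (\<lambda>i j. \<Sum>a<m. x a i * x a j)"
  have "S i j = S j i" for i j by (simp add: S_def mult.commute)
  then obtain e lam where e: "orthonormal n n e"
    and ev: "\<And>k i. k < n \<Longrightarrow> i < n \<Longrightarrow> lin n S (e k) i = lam k * e k i"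
    using symmetric_spectral[of n S] by metis
  have e1: "ip n (e k) (e l) = of_bool (k = l)" if "k < n" "l < n" for k l
    using e that by (simp add: orthonormal_def)
  have lam: "lam k = ip m (lin n x (e k)) (lin n x (e k))" if "k < n" for k
  proof -
    have "ip n (e k) (lin n S (e k)) = ip n (e k) (\<lambda>i. lam k * e k i)"
      by (rule ip_cong) (simp_all add: ev that)
    also have "\<dots> = lam k" by (subst ip_commute, subst ip_scale_left) (simp add: e1 that)
    finally show ?thesis by (simp add: S_def gram_quadratic_form)
  qed
  \<comment> \<open>The singular values of \<open>X\<close>: the eigenvalues \<open>lam k\<close> of
    the Gram matrix are squared norms, hence nonnegative.\<close>
  define s where "s = (\<lambda>k. sqrt (lam k))"
  have s: "0 \<le> s k" "(s k)\<^sup>2 = lam k" if "k < n" for k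
    by (simp_all add: s_def lam that ip_nonneg)
  \<comment> \<open>The square root of the Gram matrix: same eigenvectors, square roots of the
    eigenvalues.\<close>
  define p where "p = (\<lambda>i j. \<Sum>k<n. s k * e k i * e k j)"
  define P where "P = Matrix.mat n n (\<lambda>(i, j). p i j)"
  have pe: "lin n p (e k) i = s k * e k i" if "k < n" for k i
  proof -
    have "lin n p (e k) i = (\<Sum>l<n. s l * e l i * ip n (e l) (e k))"
      unfolding lin_def p_def ip_def sum_distrib_right sum_distrib_left
      by (subst sum.swap) (simp add: mult_ac)
    also have "\<dots> = (\<Sum>l<n. if l = k then s l * e l i else 0)"
      by (rule sum.cong) (simp_all add: e1 that)
    finally show ?thesis using that by simp
  qed
  have pv: "0 \<le> ip n v (lin n p v)" for v
  proof -
    have "ip n v (lin n p v) = (\<Sum>i<n. \<Sum>j<n. \<Sum>k<n. s k * (v i * e k i * (v j * e k j)))"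
      unfolding ip_lin_right p_def sum_distrib_left sum_distrib_right by (simp add: mult_ac)
    also have "\<dots> = (\<Sum>i<n. \<Sum>k<n. \<Sum>j<n. s k * (v i * e k i * (v j * e k j)))"
      by (intro sum.cong refl sum.swap)
    also have "\<dots> = (\<Sum>k<n. \<Sum>i<n. \<Sum>j<n. s k * (v i * e k i * (v j * e k j)))" by (rule sum.swap)
    also have "\<dots> = (\<Sum>k<n. s k * (ip n v (e k))\<^sup>2)"
      unfolding ip_def power2_eq_square sum_product by (simp add: sum_distrib_left)
    also have "\<dots> \<ge> 0" by (intro sum_nonneg mult_nonneg_nonneg) (auto simp: s)
    finally show ?thesis .
  qed
  have gram: "(transpose_mat X * X) $$ (i, j) = S i j" if "i < n" "j < n" for i j
    using X that by (simp add: scalar_prod_def S_def x_def lessThan_atLeast0)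
  have sq: "(Q * Q) $$ (i, j) = (\<Sum>l<n. Q $$ (i, l) * Q $$ (l, j))"
    if "Q \<in> carrier_mat n n" "i < n" "j < n" for Q :: "real mat" and i j
    using that by (auto simp: scalar_prod_def lessThan_atLeast0 intro!: sum.cong)
  have P: "P \<in> carrier_mat n n" "\<And>i j. i < n \<Longrightarrow> j < n \<Longrightarrow> P $$ (i, j) = p i j"
    by (simp_all add: P_def)
  have psdP: "psd_mat n P"
    unfolding psd_mat_def
  proof (intro conjI ballI)
    show "P \<in> carrier_mat n n" by (rule P)
    show "transpose_mat P = P" by (rule eq_matI) (auto simp: P_def p_def mult_ac)
    fix v :: "real Matrix.vec" assume "v \<in> carrier_vec n"
    then have v: "v = Matrix.vec n (\<lambda>i. v $ i)" by auto
    have "scalar_prod (Matrix.vec n (\<lambda>i. v $ i)) (P *\<^sub>v Matrix.vec n (\<lambda>i. v $ i)) = ip n (\<lambda>i. v $ i) (lin n p (\<lambda>i. v $ i))"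
      unfolding quadratic_form_mat[OF P(1)] by (rule ip_cong) (auto intro!: lin_cong simp: P)
    then show "0 \<le> scalar_prod v (P *\<^sub>v v)" using pv v by metis
  qed
  have PP: "P * P = transpose_mat X * X"
  proof (rule eq_matI)
    fix i j assume "i < dim_row (transpose_mat X * X)" "j < dim_col (transpose_mat X * X)"
    then have ij: "i < n" "j < n" using X by auto
    have "(P * P) $$ (i, j) = (\<Sum>l<n. p i l * p l j)" using ij by (simp add: sq P)
    also have "\<dots> = (\<Sum>k<n. lam k * e k i * e k j)"
    proof (rule eigenbasis_expansion[OF e _ ij])
      fix k assume "k < n"
      have "lin n (\<lambda>i j. \<Sum>l<n. p i l * p l j) (e k) i = lin n p (lin n p (e k)) i" by (rule lin_lin)
      \<comment> \<open>The summand 0 brings the scaled eigenvector into the form that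
        \<open>lin_add\<close> expects.\<close>
      also have "\<dots> = lin n p (\<lambda>i. 0 + s k * e k i) i" by (rule lin_cong) (simp_all add: pe \<open>k < n\<close>)
      also have "\<dots> = s k * lin n p (e k) i" by (subst lin_add) (simp add: lin_def)
      also have "\<dots> = (s k)\<^sup>2 * e k i" by (simp add: pe \<open>k < n\<close> power2_eq_square)
      finally show "lin n (\<lambda>i j. \<Sum>l<n. p i l * p l j) (e k) i = lam k * e k i" by (simp add: s \<open>k < n\<close>)
    qed
    also have "\<dots> = S i j" by (rule eigenbasis_expansion[OF e _ ij, symmetric]) (simp add: ev ij)
    finally show "(P * P) $$ (i, j) = (transpose_mat X * X) $$ (i, j)" by (simp add: gram ij)
  qed (use X P in auto)
  \<comment> \<open>Any other root \<open>Q\<close> satisfies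
    \<open>Q (Q (e k)) = (s k)^2 e k\<close>, so it has to act on each \<open>e k\<close> as
    multiplication by \<open>s k\<close>, just as \<open>P\<close> does.\<close>
  have uniq: "Q = P" if Q: "psd_mat n Q" "Q * Q = transpose_mat X * X" for Q
  proof (rule eq_matI)
    fix i j assume "i < dim_row P" "j < dim_col P"
    then have ij: "i < n" "j < n" using P by auto
    let ?q = "\<lambda>i j. Q $$ (i, j)"
    have "?q i j = (\<Sum>k<n. s k * e k i * e k j)"
    proof (rule eigenbasis_expansion[OF e _ ij])
      fix k assume k: "k < n"
      show "lin n ?q (e k) i = s k * e k i"
      proof (rule psd_sqrt_eigenvector[of n])
        fix i assume "i < n"
        have "lin n ?q (lin n ?q (e k)) i = lin n S (e k) i"
          unfolding lin_lin[symmetric] using psd_matD(1)[OF Q(1)] \<open>i < n\<close>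
          by (intro lin_cong) (simp_all add: sq[symmetric] Q(2) gram del: index_mult_mat)
        then show "lin n ?q (lin n ?q (e k)) i = (s k)\<^sup>2 * e k i" by (simp add: ev k s \<open>i < n\<close>)
      qed (use psd_matD[OF Q(1)] s k ij in auto)
    qed
    then show "Q $$ (i, j) = P $$ (i, j)" using P ij by (simp add: p_def)
  qed (use P psd_matD(1)[OF Q(1)] in auto)
  have "(THE P. psd_mat n P \<and> P * P = transpose_mat X * X) = P"
  proof (rule the_equality)
    show "psd_mat n P \<and> P * P = transpose_mat X * X" using psdP PP by (rule conjI)
    show "Q = P" if "psd_mat n Q \<and> Q * Q = transpose_mat X * X" for Q
      using that[THEN conjunct1] that[THEN conjunct2] by (rule uniq)
  qed
  moreover have "dim_col X = n" using X by (rule carrier_matD)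
  ultimately have "nuclear_norm X = mat_trace P" unfolding nuclear_norm_def by (simp only:)
  also have "\<dots> = (\<Sum>i<n. p i i)"
    using P by (simp add: mat_trace_def)
  also have "\<dots> = (\<Sum>k<n. s k * ip n (e k) (e k))"
    unfolding p_def ip_def sum_distrib_left by (subst sum.swap) (simp add: mult_ac)
  also have "\<dots> = (\<Sum>k<n. s k)" by (simp add: e1)
  finally show thesis using that[OF e s(1)] s(2) lam unfolding x_def by simp
qed

text \<open>The entrywise pairing is the trace of \<open>X^T B\<close>. Computed in the right
  singular basis it is the sum of the pairings of \<open>X (e k)\<close> with
  \<open>B (e k)\<close>; since \<open>X (e k)\<close> has norm \<open>s k\<close>, each of them is
  at most \<open>\<sigma> * s k\<close>.\<close>

lemma nuclear_norm_duality:
  assumes X: "X \<in> carrier_mat m n"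
    and \<sigma>: "\<And>u v. ip m u u \<le> 1 \<Longrightarrow> ip n v v \<le> 1 \<Longrightarrow> ip m u (lin n B v) \<le> \<sigma>"
  shows "(\<Sum>a<m. \<Sum>i<n. X $$ (a, i) * B a i) \<le> \<sigma> * nuclear_norm X"
proof -
  define x where "x = (\<lambda>a i. X $$ (a, i))"
  obtain e s where e: "orthonormal n n e" and s: "\<And>k. k < n \<Longrightarrow> 0 \<le> s k"
    "\<And>k. k < n \<Longrightarrow> ip m (lin n x (e k)) (lin n x (e k)) = (s k)\<^sup>2"
    and nn: "nuclear_norm X = (\<Sum>k<n. s k)"
    using nuclear_norm_svd[OF X] unfolding x_def by metis
  have "(\<Sum>a<m. \<Sum>i<n. x a i * B a i) = (\<Sum>a<m. \<Sum>k<n. lin n x (e k) a * lin n B (e k) a)"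
  proof (rule sum.cong)
    fix a
    have "(\<Sum>i<n. x a i * B a i) = (\<Sum>i<n. \<Sum>j<n. x a j * of_bool (i = j) * B a i)"
      by (intro sum.cong refl) (simp add: of_bool_def if_distrib[of "\<lambda>x. _ * x"] if_distrib[of "\<lambda>x. x * _"] cong: if_cong)
    also have "\<dots> = (\<Sum>i<n. \<Sum>j<n. \<Sum>k<n. x a j * e k j * (B a i * e k i))"
      by (intro sum.cong refl)
        (simp add: orthonormal_complete[OF e, symmetric] sum_distrib_left sum_distrib_right mult_ac)
    also have "\<dots> = (\<Sum>i<n. \<Sum>k<n. \<Sum>j<n. x a j * e k j * (B a i * e k i))"
      by (intro sum.cong refl sum.swap)
    also have "\<dots> = (\<Sum>k<n. \<Sum>i<n. \<Sum>j<n. x a j * e k j * (B a i * e k i))" by (rule sum.swap)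
    also have "\<dots> = (\<Sum>k<n. lin n B (e k) a * lin n x (e k) a)"
      unfolding lin_def sum_product by (simp add: mult_ac)
    finally show "(\<Sum>i<n. x a i * B a i) = (\<Sum>k<n. lin n x (e k) a * lin n B (e k) a)"
      by (simp add: mult.commute)
  qed simp
  also have "\<dots> = (\<Sum>k<n. ip m (lin n x (e k)) (lin n B (e k)))"
    unfolding ip_def by (rule sum.swap)
  also have "\<dots> \<le> (\<Sum>k<n. \<sigma> * s k)"
  proof (rule sum_mono)
    fix k assume "k \<in> {..<n}"
    then have k: "k < n" by simp
    show "ip m (lin n x (e k)) (lin n B (e k)) \<le> \<sigma> * s k"
    proof (cases "s k = 0")
      case True
      then have "\<forall>a<m. lin n x (e k) a = 0" using s(2)[OF k] by (simp add: ip_eq_0_iff)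
      then show ?thesis using True by (simp add: ip_def)
    next
      case False
      then have pos: "0 < s k" using s(1)[OF k] by simp
      let ?u = "\<lambda>a. (1 / s k) * lin n x (e k) a"
      have "ip m ?u ?u = 1"
        by (subst ip_scale_left, subst ip_commute, subst ip_scale_left)
          (use s(2)[OF k] pos in \<open>simp add: power2_eq_square\<close>)
      moreover have "ip n (e k) (e k) = 1" using e k by (simp add: orthonormal_def)
      ultimately have "ip m ?u (lin n B (e k)) \<le> \<sigma>" by (intro \<sigma>) auto
      then have "(1 / s k) * ip m (lin n x (e k)) (lin n B (e k)) \<le> \<sigma>"
        by (subst (asm) ip_scale_left)
      then show ?thesis using pos by (simp add: field_simps)
    qed
  qed
  also have "\<dots> = \<sigma> * nuclear_norm X" by (simp add: nn sum_distrib_left)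
  finally show ?thesis by (simp add: x_def)
qed

lemma nuclear_norm_nonneg: "X \<in> carrier_mat m n \<Longrightarrow> 0 \<le> nuclear_norm X"
  by (rule nuclear_norm_svd[of X m n]) (auto intro!: sum_nonneg)

section \<open>Bounded differences\<close>

lemma finite_set_Pi_pmf:
  assumes "finite A" "\<And>x. x \<in> A \<Longrightarrow> finite (set_pmf (p x))"
  shows "finite (set_pmf (Pi_pmf A d p))"
  using assms by (simp add: set_Pi_pmf finite_PiE_dflt)

lemma expectation_pair_pmf_finite:
  fixes f :: "'a \<times> 'b \<Rightarrow> real"
  assumes "finite (set_pmf P)" "finite (set_pmf Q)"
  shows "measure_pmf.expectation (pair_pmf P Q) f =
    measure_pmf.expectation P (\<lambda>y. measure_pmf.expectation Q (\<lambda>g. f (y, g)))"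
proof -
  have "measure_pmf.expectation (pair_pmf P Q) f = (\<Sum>z\<in>set_pmf P \<times> set_pmf Q. f z * pmf (pair_pmf P Q) z)"
    by (rule integral_measure_pmf_real) (use assms in auto)
  also have "\<dots> = (\<Sum>y\<in>set_pmf P. \<Sum>g\<in>set_pmf Q. f (y, g) * (pmf P y * pmf Q g))"
    by (subst sum.cartesian_product) (auto simp: pmf_pair intro!: sum.cong)
  also have "\<dots> = (\<Sum>y\<in>set_pmf P. (\<Sum>g\<in>set_pmf Q. f (y, g) * pmf Q g) * pmf P y)"
    by (simp add: sum_distrib_left sum_distrib_right mult_ac)
  also have "\<dots> = measure_pmf.expectation P (\<lambda>y. \<Sum>g\<in>set_pmf Q. f (y, g) * pmf Q g)"
    by (rule integral_measure_pmf_real[symmetric]) (use assms in auto)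
  also have "(\<lambda>y. \<Sum>g\<in>set_pmf Q. f (y, g) * pmf Q g) = (\<lambda>y. measure_pmf.expectation Q (\<lambda>g. f (y, g)))"
    by (intro ext integral_measure_pmf_real[symmetric]) (use assms in auto)
  finally show ?thesis .
qed

text \<open>With \<open>a\<close> the minimum of \<open>F\<close> on the support, the oscillation
  bound confines \<open>F\<close> to the interval from \<open>a\<close> to \<open>a + c\<close>, so
  Hoeffding's lemma applies to the centred variable.\<close>

lemma hoeffding_mgf_finite:
  fixes F :: "'a \<Rightarrow> real"
  assumes fin: "finite (set_pmf P)" and c: "\<And>y y'. \<bar>F y - F y'\<bar> \<le> c" and "0 < l"
  shows "measure_pmf.expectation P (\<lambda>y. exp (l * F y)) \<le>
    exp (l * measure_pmf.expectation P F + l\<^sup>2 * c\<^sup>2 / 8)"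
proof -
  define a where "a = Min (F ` set_pmf P)"
  define \<mu> where "\<mu> = measure_pmf.expectation P F"
  have ne: "F ` set_pmf P \<noteq> {}" by (simp add: set_pmf_not_empty)
  have "a \<in> F ` set_pmf P" unfolding a_def using ne fin by (intro Min_in) auto
  then obtain y0 where y0: "a = F y0" by auto
  have "F y \<in> {a..a + c}" if "y \<in> set_pmf P" for y
    using c[of y y0] Min_le[of "F ` set_pmf P" "F y"] fin that by (auto simp: a_def[symmetric] y0[symmetric])
  then interpret interval_bounded_random_variable "measure_pmf P" F a "a + c"
    by unfold_locales (auto simp: AE_measure_pmf_iff)
  have "ennreal (measure_pmf.expectation P (\<lambda>y. exp (l * (F y - \<mu>)))) =
      (\<integral>\<^sup>+y. exp (l * (F y - \<mu>)) \<partial>measure_pmf P)"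
    by (rule nn_integral_eq_integral[symmetric]) (auto intro!: integrable_measure_pmf_finite fin)
  also have "\<dots> \<le> ennreal (exp (l\<^sup>2 * (a + c - a)\<^sup>2 / 8))"
    unfolding \<mu>_def by (rule Hoeffdings_lemma_nn_integral[OF \<open>0 < l\<close>])
  finally have 1: "measure_pmf.expectation P (\<lambda>y. exp (l * (F y - \<mu>))) \<le> exp (l\<^sup>2 * c\<^sup>2 / 8)"
    by simp
  have "measure_pmf.expectation P (\<lambda>y. exp (l * F y)) =
      measure_pmf.expectation P (\<lambda>y. exp (l * \<mu>) * exp (l * (F y - \<mu>)))"
    by (simp add: exp_add[symmetric] algebra_simps)
  also have "\<dots> = exp (l * \<mu>) * measure_pmf.expectation P (\<lambda>y. exp (l * (F y - \<mu>)))" by simp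
  also have "\<dots> \<le> exp (l * \<mu>) * exp (l\<^sup>2 * c\<^sup>2 / 8)" using 1 by (intro mult_left_mono) auto
  finally show ?thesis by (simp add: exp_add[symmetric] \<mu>_def)
qed

text \<open>Induction on the coordinates takes the place of a martingale. With the new coordinate
  frozen at \<open>y\<close>, the induction hypothesis bounds the conditional moment generating
  function through the conditional mean \<open>F y\<close>; then \<open>F\<close>, as a function of
  one variable, falls to Hoeffding's lemma.\<close>

lemma mcdiarmid_mgf:
  fixes f :: "('a \<Rightarrow> 'b) \<Rightarrow> real" and p :: "'a \<Rightarrow> 'b pmf"
  assumes "finite A" and fin: "\<And>x. x \<in> A \<Longrightarrow> finite (set_pmf (p x))" and "0 < l"
    and "\<And>x g y y'. x \<in> A \<Longrightarrow> \<bar>f (g(x := y)) - f (g(x := y'))\<bar> \<le> c x"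
  shows "measure_pmf.expectation (Pi_pmf A d p) (\<lambda>g. exp (l * f g)) \<le>
    exp (l * measure_pmf.expectation (Pi_pmf A d p) f + l\<^sup>2 * (\<Sum>x\<in>A. (c x)\<^sup>2) / 8)"
  using assms(1,2,4)
proof (induction A arbitrary: f rule: finite_induct)
  case empty
  then show ?case by simp
next
  case (insert x A)
  let ?P = "Pi_pmf A d p"
  have finA: "finite (set_pmf ?P)" using insert by (intro finite_set_Pi_pmf) auto
  have finx: "finite (set_pmf (p x))" using insert by auto
  have E: "measure_pmf.expectation (Pi_pmf (insert x A) d p) h =
      measure_pmf.expectation (p x) (\<lambda>y. measure_pmf.expectation ?P (\<lambda>g. h (g(x := y))))" for h :: "_ \<Rightarrow> real"
    by (subst Pi_pmf_insert[OF insert(1,2)])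
      (simp add: expectation_pair_pmf_finite finA finx split_def)
  define F where "F = (\<lambda>y. measure_pmf.expectation ?P (\<lambda>g. f (g(x := y))))"
  let ?V = "l\<^sup>2 * (\<Sum>x\<in>A. (c x)\<^sup>2) / 8"
  have inner: "measure_pmf.expectation ?P (\<lambda>g. exp (l * f (g(x := y)))) \<le> exp (l * F y + ?V)" for y
    unfolding F_def
  proof (rule insert.IH)
    fix x' g z z' assume "x' \<in> A"
    then have "x' \<noteq> x" using insert by auto
    then have "(g(x' := z))(x := y) = (g(x := y))(x' := z)" for z by (rule fun_upd_twist)
    then show "\<bar>f ((g(x' := z))(x := y)) - f ((g(x' := z'))(x := y))\<bar> \<le> c x'"
      using \<open>x' \<in> A\<close> by (simp only:) (rule insert.prems(2), simp)
  qed (use insert.prems in auto)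
  \<comment> \<open>Averaging over the remaining coordinates does not increase the oscillation in
    coordinate \<open>x\<close>.\<close>
  have Fc: "\<bar>F y - F y'\<bar> \<le> c x" for y y'
  proof -
    have "F y - F y' = measure_pmf.expectation ?P (\<lambda>g. f (g(x := y)) - f (g(x := y')))"
      unfolding F_def by (rule Bochner_Integration.integral_diff[symmetric])
        (auto intro!: integrable_measure_pmf_finite finA)
    also have "\<bar>\<dots>\<bar> \<le> measure_pmf.expectation ?P (\<lambda>g. \<bar>f (g(x := y)) - f (g(x := y'))\<bar>)"
      by (rule integral_abs_bound)
    also have "\<dots> \<le> measure_pmf.expectation ?P (\<lambda>g. c x)"
      by (rule integral_mono) (auto intro!: integrable_measure_pmf_finite finA insert.prems(2))
    finally show ?thesis by simp
  qed
  have "measure_pmf.expectation (Pi_pmf (insert x A) d p) (\<lambda>g. exp (l * f g)) \<le>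
      measure_pmf.expectation (p x) (\<lambda>y. exp ?V * exp (l * F y))"
    unfolding E by (rule integral_mono)
      (use inner in \<open>auto intro!: integrable_measure_pmf_finite finx simp: exp_add[symmetric] add.commute\<close>)
  also have "\<dots> = exp ?V * measure_pmf.expectation (p x) (\<lambda>y. exp (l * F y))" by simp
  also have "\<dots> \<le> exp ?V * exp (l * measure_pmf.expectation (p x) F + l\<^sup>2 * (c x)\<^sup>2 / 8)"
    by (intro mult_left_mono hoeffding_mgf_finite finx Fc \<open>0 < l\<close>) auto
  also have "measure_pmf.expectation (p x) F = measure_pmf.expectation (Pi_pmf (insert x A) d p) f"
    by (simp add: E F_def)
  also have "exp ?V * exp (l * measure_pmf.expectation (Pi_pmf (insert x A) d p) f + l\<^sup>2 * (c x)\<^sup>2 / 8) =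
     exp (l * measure_pmf.expectation (Pi_pmf (insert x A) d p) f + l\<^sup>2 * (\<Sum>x\<in>insert x A. (c x)\<^sup>2) / 8)"
    using insert(1,2) by (simp add: exp_add[symmetric] algebra_simps add_divide_distrib)
  finally show ?case .
qed

lemma mcdiarmid:
  fixes f :: "('a \<Rightarrow> 'b) \<Rightarrow> real" and p :: "'a \<Rightarrow> 'b pmf"
  assumes "finite A" and fin: "\<And>x. x \<in> A \<Longrightarrow> finite (set_pmf (p x))" and "0 < \<epsilon>"
    and bd: "\<And>x g y y'. x \<in> A \<Longrightarrow> \<bar>f (g(x := y)) - f (g(x := y'))\<bar> \<le> c x"
    and V: "0 < (\<Sum>x\<in>A. (c x)\<^sup>2)"
  shows "measure_pmf.prob (Pi_pmf A d p) {g. measure_pmf.expectation (Pi_pmf A d p) f + \<epsilon> \<le> f g}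
    \<le> exp (- 2 * \<epsilon>\<^sup>2 / (\<Sum>x\<in>A. (c x)\<^sup>2))"
proof -
  let ?P = "Pi_pmf A d p"
  let ?E = "measure_pmf.expectation ?P"
  let ?V = "\<Sum>x\<in>A. (c x)\<^sup>2"
  \<comment> \<open>The minimizer of the Chernoff exponent
    \<open>l^2 * ?V / 8 - l * \<epsilon>\<close>.\<close>
  define l where "l = 4 * \<epsilon> / ?V"
  have "0 < l" using V \<open>0 < \<epsilon>\<close> by (simp add: l_def)
  have finP: "finite (set_pmf ?P)" by (intro finite_set_Pi_pmf assms)
  have "measure_pmf.prob ?P {g. ?E f + \<epsilon> \<le> f g} = ?E (\<lambda>g. indicator {g. ?E f + \<epsilon> \<le> f g} g)" by simp
  also have "\<dots> \<le> ?E (\<lambda>g. exp (- l * (?E f + \<epsilon>)) * exp (l * f g))"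
  proof (rule integral_mono)
    fix g
    show "indicator {g. ?E f + \<epsilon> \<le> f g} g \<le> exp (- l * (?E f + \<epsilon>)) * exp (l * f g)"
      using \<open>0 < l\<close> by (auto simp: indicator_def exp_add[symmetric])
  qed (auto intro!: integrable_measure_pmf_finite finP)
  also have "\<dots> = exp (- l * (?E f + \<epsilon>)) * ?E (\<lambda>g. exp (l * f g))" by simp
  also have "\<dots> \<le> exp (- l * (?E f + \<epsilon>)) * exp (l * ?E f + l\<^sup>2 * ?V / 8)"
    by (intro mult_left_mono mcdiarmid_mgf assms \<open>0 < l\<close>) auto
  also have "\<dots> = exp (l\<^sup>2 * ?V / 8 - l * \<epsilon>)" by (simp add: exp_add[symmetric] algebra_simps)
  also have "l\<^sup>2 * ?V / 8 - l * \<epsilon> = - 2 * \<epsilon>\<^sup>2 / ?V"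
    using V by (simp add: l_def power2_eq_square field_simps)
  finally show ?thesis .
qed

section \<open>Operator norm of a noise matrix\<close>

text \<open>Integer points of norm at most \<open>2 * sqrt m\<close> replace a net of the sphere of
  radius \<open>sqrt m\<close>. Using \<open>PiE\<close> fixes the values outside the index range,
  which makes the set finite.\<close>

definition lattice_ball :: "nat \<Rightarrow> (nat \<Rightarrow> int) set" where
  "lattice_ball m = {z \<in> PiE {..<m} (\<lambda>_. UNIV). (\<Sum>i<m. (z i)\<^sup>2) \<le> 4 * int m}"

text \<open>The geometric correction makes the induction go through: the two new terms are each at
  most \<open>(1/2) ^ Suc K\<close>, because
  \<open>exp (- k^2) \<le> exp (- k) \<le> (1/2) ^ k\<close>, and together they use up exactly the
  decrease of the correction.\<close>

lemma gaussian_sum_le: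
  "(\<Sum>k\<in>{- int K..int K}. exp (- (real_of_int k)\<^sup>2)) \<le> 3 - 2 * (1 / 2) ^ K"
proof (induction K)
  case 0
  then show ?case by simp
next
  case (Suc K)
  have "{- int (Suc K)..int (Suc K)} = insert (- int (Suc K)) (insert (int (Suc K)) {- int K..int K})"
    by auto
  then have "(\<Sum>k\<in>{- int (Suc K)..int (Suc K)}. exp (- (real_of_int k)\<^sup>2)) =
      2 * exp (- (real (Suc K))\<^sup>2) + (\<Sum>k\<in>{- int K..int K}. exp (- (real_of_int k)\<^sup>2))"
    by (simp add: power2_eq_square algebra_simps)
  moreover have "exp (- (real (Suc K))\<^sup>2) \<le> (1 / 2) ^ Suc K"
  proof -
    have "exp (- (real (Suc K))\<^sup>2) \<le> exp (real (Suc K) * (- 1))"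
      using mult_left_mono[of 1 "real (Suc K)" "real (Suc K)"] by (simp add: power2_eq_square del: of_nat_Suc)
    also have "\<dots> = exp (- 1) ^ Suc K" by (rule exp_of_nat_mult)
    also have "\<dots> \<le> (1 / 2) ^ Suc K"
      using exp_ge_add_one_self[of 1] by (intro power_mono) (simp_all add: exp_minus field_simps)
    finally show ?thesis .
  qed
  ultimately show ?case using Suc.IH by simp
qed

text \<open>Counting with the weight \<open>exp (4 m - \<Sum> (z i)\<^sup>2) \<ge> 1\<close> makes the bound factor over the coordinates.\<close>

lemma lattice_ball_card: "finite (lattice_ball m)" "real (card (lattice_ball m)) \<le> exp (6 * real m)"
proof -
  \<comment> \<open>A crude box, since \<open>\<bar>z i\<bar> \<le> (z i)^2 \<le> 4 m\<close>; it
    provides finiteness and a product domain over which the sum factors.\<close>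
  define B where "B = PiE {..<m} (\<lambda>_. {- int (4 * m)..int (4 * m)})"
  have sub: "lattice_ball m \<subseteq> B"
  proof
    fix z assume z: "z \<in> lattice_ball m"
    have "\<bar>z i\<bar> \<le> int (4 * m)" if "i < m" for i
    proof -
      have "\<bar>z i\<bar> \<le> (z i)\<^sup>2" using self_le_power[of "\<bar>z i\<bar>" 2] by (cases "z i = 0") auto
      also have "\<dots> \<le> (\<Sum>i<m. (z i)\<^sup>2)" by (rule member_le_sum) (use that in auto)
      finally show ?thesis using z by (simp add: lattice_ball_def)
    qed
    then show "z \<in> B" using z by (fastforce simp: B_def lattice_ball_def abs_le_iff PiE_iff)
  qed
  have "finite B" unfolding B_def by (intro finite_PiE) auto
  then show "finite (lattice_ball m)" using sub by (rule rev_finite_subset)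
  have "real (card (lattice_ball m)) = (\<Sum>z\<in>lattice_ball m. 1)" by simp
  also have "\<dots> \<le> (\<Sum>z\<in>lattice_ball m. \<Prod>i<m. exp (4 - (real_of_int (z i))\<^sup>2))"
  proof (rule sum_mono)
    fix z assume "z \<in> lattice_ball m"
    then have "(\<Sum>i<m. (z i)\<^sup>2) \<le> 4 * int m" by (simp add: lattice_ball_def)
    then have "real_of_int (\<Sum>i<m. (z i)\<^sup>2) \<le> real_of_int (4 * int m)" by (simp only: of_int_le_iff)
    then have "0 \<le> (\<Sum>i<m. 4 - (real_of_int (z i))\<^sup>2)" by (simp add: sum_subtractf)
    then have "1 \<le> exp (\<Sum>i<m. 4 - (real_of_int (z i))\<^sup>2)" by (simp only: one_le_exp_iff)
    then show "1 \<le> (\<Prod>i<m. exp (4 - (real_of_int (z i))\<^sup>2))" by (simp add: exp_sum)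
  qed
  also have "\<dots> \<le> (\<Sum>z\<in>B. \<Prod>i<m. exp (4 - (real_of_int (z i))\<^sup>2))"
    by (rule sum_mono2) (use sub \<open>finite B\<close> in \<open>auto intro!: prod_nonneg\<close>)
  also have "\<dots> = (\<Prod>i<m. \<Sum>k\<in>{- int (4 * m)..int (4 * m)}. exp (4 - (real_of_int k)\<^sup>2))"
    unfolding B_def by (rule prod_sum_PiE[symmetric]) auto
  also have "\<dots> = (exp 4 * (\<Sum>k\<in>{- int (4 * m)..int (4 * m)}. exp (- (real_of_int k)\<^sup>2))) ^ m"
    by (simp add: sum_distrib_left exp_add[symmetric])
  also have "\<dots> \<le> exp 6 ^ m"
  proof (rule power_mono)
    have "(\<Sum>k\<in>{- int (4 * m)..int (4 * m)}. exp (- (real_of_int k)\<^sup>2)) \<le> 3"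
      using gaussian_sum_le[of "4 * m"] by (smt (verit) zero_le_power divide_nonneg_nonneg)
    also have "3 \<le> exp (2::real)" using exp_ge_add_one_self[of 2] by simp
    finally have "exp 4 * (\<Sum>k\<in>{- int (4 * m)..int (4 * m)}. exp (- (real_of_int k)\<^sup>2)) \<le> exp 4 * exp 2"
      by (intro mult_left_mono) auto
    then show "exp 4 * (\<Sum>k\<in>{- int (4 * m)..int (4 * m)}. exp (- (real_of_int k)\<^sup>2)) \<le> exp 6"
      by (simp add: exp_add[symmetric])
  qed (auto intro!: sum_nonneg mult_nonneg_nonneg)
  also have "\<dots> = exp (6 * real m)" by (simp add: exp_of_nat_mult[symmetric] mult.commute)
  finally show "real (card (lattice_ball m)) \<le> exp (6 * real m)" .
qed

lemma lattice_ball_norm: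
  assumes "z \<in> lattice_ball m"
  shows "(\<Sum>i<m. (real_of_int (z i))\<^sup>2) \<le> 4 * real m"
proof -
  have "(\<Sum>i<m. (z i)\<^sup>2) \<le> 4 * int m" using assms by (simp add: lattice_ball_def)
  then have "real_of_int (\<Sum>i<m. (z i)\<^sup>2) \<le> real_of_int (4 * int m)" by (simp only: of_int_le_iff)
  then show ?thesis by simp
qed

text \<open>Each coordinate of \<open>sqrt m * u\<close> is rounded in the direction that increases the pairing with \<open>h\<close>;
  hence, unlike for an epsilon-net, passing to the lattice costs no multiplicative factor.\<close>

lemma lattice_ball_rounding:
  assumes "ip m u u \<le> 1"
  obtains z where "z \<in> lattice_ball m" "sqrt (real m) * ip m u h \<le> ip m (\<lambda>i. real_of_int (z i)) h"
proof -
  define x where "x = (\<lambda>i. sqrt (real m) * u i)"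
  define z where "z = (\<lambda>i. if i < m then if 0 \<le> h i then \<lceil>x i\<rceil> else \<lfloor>x i\<rfloor> else undefined)"
  \<comment> \<open>Rounding moves a coordinate by at most 1, so squares grow to at most
    \<open>2 x^2 + 2\<close>. The total is at most \<open>2 m + 2 m\<close>, the radius built into
    \<open>lattice_ball\<close>.\<close>
  have "(\<Sum>i<m. (real_of_int (z i))\<^sup>2) \<le> (\<Sum>i<m. 2 * (x i)\<^sup>2 + 2)"
  proof (rule sum_mono)
    fix i assume "i \<in> {..<m}"
    then have "\<bar>z i - x i\<bar> \<le> 1" by (auto simp: z_def) linarith+
    then have "(z i - x i)\<^sup>2 \<le> 1" by (simp add: abs_square_le_1)
    moreover have "(real_of_int (z i))\<^sup>2 \<le> 2 * (x i)\<^sup>2 + 2 * (z i - x i)\<^sup>2"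
      using zero_le_power2[of "2 * x i - z i"] by (simp add: power2_eq_square algebra_simps)
    ultimately show "(real_of_int (z i))\<^sup>2 \<le> 2 * (x i)\<^sup>2 + 2" by linarith
  qed
  also have "\<dots> = 2 * (real m * ip m u u) + 2 * real m"
    by (simp add: sum.distrib x_def power_mult_distrib ip_def sum_distrib_left power2_eq_square[symmetric] mult.assoc)
  also have "\<dots> \<le> 4 * real m" using mult_left_mono[OF assms, of "real m"] by simp
  finally have "real_of_int (\<Sum>i<m. (z i)\<^sup>2) \<le> real_of_int (4 * int m)" by simp
  then have "(\<Sum>i<m. (z i)\<^sup>2) \<le> 4 * int m" by (simp only: of_int_le_iff)
  then have "z \<in> lattice_ball m" by (simp add: lattice_ball_def z_def PiE_def extensional_def)
  moreover have "ip m x h \<le> ip m (\<lambda>i. real_of_int (z i)) h"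
    unfolding ip_def
  proof (rule sum_mono)
    fix i assume "i \<in> {..<m}"
    then show "x i * h i \<le> real_of_int (z i) * h i"
      by (cases "0 \<le> h i") (auto simp: z_def intro: mult_right_mono mult_right_mono_neg)
  qed
  then have "sqrt (real m) * ip m u h \<le> ip m (\<lambda>i. real_of_int (z i)) h"
    by (simp add: x_def ip_scale_left)
  ultimately show thesis by (rule that)
qed

text \<open>A maximum over finitely many bilinear forms that dominates the operator norm.\<close>

definition net_norm :: "nat \<Rightarrow> nat \<Rightarrow> (nat \<times> nat \<Rightarrow> real) \<Rightarrow> real" where
  "net_norm m n B = Max ((\<lambda>(z, w). \<Sum>(i, j)\<in>{..<m} \<times> {..<n}.
     real_of_int (z i) * real_of_int (w j) / sqrt (real m * real n) * B (i, j)) ` (lattice_ball m \<times> lattice_ball n))"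

lemma net_norm_ge:
  assumes "z \<in> lattice_ball m" "w \<in> lattice_ball n"
  shows "(\<Sum>(i, j)\<in>{..<m} \<times> {..<n}. real_of_int (z i) * real_of_int (w j) / sqrt (real m * real n) * B (i, j))
    \<le> net_norm m n B"
  unfolding net_norm_def
  by (rule Max_ge) (use assms lattice_ball_card(1) in \<open>auto intro!: image_eqI[of _ _ "(z, w)"]\<close>)

lemma net_norm_attained:
  obtains z w where "z \<in> lattice_ball m" "w \<in> lattice_ball n"
    "net_norm m n B =
      (\<Sum>(i, j)\<in>{..<m} \<times> {..<n}. real_of_int (z i) * real_of_int (w j) / sqrt (real m * real n) * B (i, j))"
proof -
  have "(\<lambda>i\<in>{..<m}. 0) \<in> lattice_ball m" for m by (simp add: lattice_ball_def)
  then have "lattice_ball m \<times> lattice_ball n \<noteq> {}" by blast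
  then have "net_norm m n B \<in> (\<lambda>(z, w). \<Sum>(i, j)\<in>{..<m} \<times> {..<n}.
     real_of_int (z i) * real_of_int (w j) / sqrt (real m * real n) * B (i, j)) ` (lattice_ball m \<times> lattice_ball n)"
    unfolding net_norm_def using lattice_ball_card(1) by (intro Max_in) auto
  then show thesis using that by auto
qed

text \<open>Round one argument at a time: first \<open>u\<close> against the image of
  \<open>v\<close>, then \<open>v\<close> against the transposed image of the rounded
  \<open>u\<close>. Neither step decreases the scaled form.\<close>

lemma bilinear_le_net_norm:
  assumes "0 < m" "0 < n" and u: "ip m u u \<le> 1" and v: "ip n v v \<le> 1"
  shows "ip m u (lin n (\<lambda>i j. B (i, j)) v) \<le> net_norm m n B"
proof -
  let ?B = "\<lambda>i j. B (i, j)"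
  obtain z where z: "z \<in> lattice_ball m"
    "sqrt (real m) * ip m u (lin n ?B v) \<le> ip m (\<lambda>i. real_of_int (z i)) (lin n ?B v)"
    using lattice_ball_rounding[OF u] by metis
  let ?h = "lin m (\<lambda>i j. ?B j i) (\<lambda>i. real_of_int (z i))"
  obtain w where w: "w \<in> lattice_ball n" "sqrt (real n) * ip n v ?h \<le> ip n (\<lambda>i. real_of_int (w i)) ?h"
    using lattice_ball_rounding[OF v] by metis
  have tr: "ip n y ?h = ip m (\<lambda>i. real_of_int (z i)) (lin n ?B y)" for y
    unfolding ip_lin_transpose[of m "\<lambda>i. real_of_int (z i)" n ?B y] by (rule ip_commute)
  have "sqrt (real m * real n) * ip m u (lin n ?B v) = sqrt (real n) * (sqrt (real m) * ip m u (lin n ?B v))"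
    by (simp add: real_sqrt_mult)
  also have "\<dots> \<le> sqrt (real n) * ip m (\<lambda>i. real_of_int (z i)) (lin n ?B v)"
    by (intro mult_left_mono z) auto
  also have "\<dots> = sqrt (real n) * ip n v ?h" by (simp only: tr)
  also have "\<dots> \<le> ip n (\<lambda>i. real_of_int (w i)) ?h" by (rule w)
  also have "\<dots> = ip m (\<lambda>i. real_of_int (z i)) (lin n ?B (\<lambda>i. real_of_int (w i)))" by (rule tr)
  also have "\<dots> = sqrt (real m * real n) * (\<Sum>(i, j)\<in>{..<m} \<times> {..<n}.
      real_of_int (z i) * real_of_int (w j) / sqrt (real m * real n) * B (i, j))"
    using assms(1,2) unfolding ip_lin_right sum.cartesian_product sum_distrib_left
    by (intro sum.cong) (auto simp: mult_ac)
  also have "\<dots> \<le> sqrt (real m * real n) * net_norm m n B"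
    by (intro mult_left_mono net_norm_ge z w) auto
  finally show ?thesis using assms(1,2) by (simp add: mult_le_cancel_left)
qed

lemma net_norm_nonneg: "0 < m \<Longrightarrow> 0 < n \<Longrightarrow> 0 \<le> net_norm m n B"
  using bilinear_le_net_norm[of m n "\<lambda>_. 0" "\<lambda>_. 0" B] by (simp add: ip_def)

section \<open>Expected maximum of the lattice forms\<close>

lemma weighted_sum_update:
  fixes d :: "'a \<Rightarrow> real"
  assumes "finite A" "x \<in> A"
  shows "(\<Sum>a\<in>A. d a * W a ((g(x := y)) a)) - (\<Sum>a\<in>A. d a * W a ((g(x := y')) a)) = d x * (W x y - W x y')"
proof -
  have "(\<Sum>a\<in>A - {x}. d a * W a ((g(x := y)) a)) = (\<Sum>a\<in>A - {x}. d a * W a ((g(x := y')) a))"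
    by (rule sum.cong) auto
  then show ?thesis by (simp add: sum.remove[OF assms] algebra_simps)
qed

lemma expectation_Pi_pmf_component:
  assumes "finite A" "x \<in> A"
  shows "measure_pmf.expectation (Pi_pmf A d p) (\<lambda>g. h (g x)) = measure_pmf.expectation (p x) (h :: _ \<Rightarrow> real)"
proof -
  have "measure_pmf.expectation (Pi_pmf A d p) (\<lambda>g. h (g x)) =
      measure_pmf.expectation (map_pmf (\<lambda>g. g x) (Pi_pmf A d p)) h" by simp
  also have "map_pmf (\<lambda>g. g x) (Pi_pmf A d p) = p x"
    using assms by (simp add: Pi_pmf_component)
  finally show ?thesis .
qed

text \<open>The exponential of a maximum is at most the sum of the exponentials. Each form has
  squared coefficients summing to at most 16, hence moment generating function at most
  \<open>exp (2 * l^2)\<close>, and there are at most \<open>exp (6 * l^2)\<close> forms. Together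
  this is \<open>exp (8 * l^2)\<close>, so the mean is at most \<open>8 * l\<close>.\<close>

lemma expectation_net_norm:
  fixes W :: "nat \<times> nat \<Rightarrow> 'b \<Rightarrow> real" and m n :: nat
  assumes mn: "0 < m" "0 < n"
    and fin: "\<And>x. x \<in> {..<m} \<times> {..<n} \<Longrightarrow> finite (set_pmf (p x))"
    and W1: "\<And>x y y'. x \<in> {..<m} \<times> {..<n} \<Longrightarrow> \<bar>W x y - W x y'\<bar> \<le> 1"
    and W0: "\<And>x. x \<in> {..<m} \<times> {..<n} \<Longrightarrow> measure_pmf.expectation (p x) (W x) = 0"
  shows "measure_pmf.expectation (Pi_pmf ({..<m} \<times> {..<n}) d p) (\<lambda>g. net_norm m n (\<lambda>x. W x (g x)))
    \<le> 8 * sqrt (real m + real n)"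
proof -
  let ?A = "{..<m} \<times> {..<n}"
  let ?P = "Pi_pmf ?A d p"
  let ?E = "measure_pmf.expectation ?P"
  let ?L = "lattice_ball m \<times> lattice_ball n"
  let ?N = "\<lambda>g. net_norm m n (\<lambda>x. W x (g x))"
  \<comment> \<open>Chosen so that the logarithm of the number of forms and the subgaussian exponent
    are both multiples of \<open>l^2\<close>.\<close>
  define l where "l = sqrt (real m + real n)"
  have l: "0 < l" "l\<^sup>2 = real m + real n" using mn by (simp_all add: l_def)
  define c where "c = (\<lambda>(z, w) (i :: nat, j :: nat). real_of_int (z i) * real_of_int (w j) / sqrt (real m * real n))"
  define F where "F = (\<lambda>q g. \<Sum>x\<in>?A. c q x * W x (g x))"
  have finP: "finite (set_pmf ?P)" by (rule finite_set_Pi_pmf) (use fin in auto)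
  note int = integrable_measure_pmf_finite[OF finP]
  have mgf: "?E (\<lambda>g. exp (l * F q g)) \<le> exp (2 * l\<^sup>2)" if q: "q \<in> ?L" for q
  proof -
    obtain z w where zw: "q = (z, w)" "z \<in> lattice_ball m" "w \<in> lattice_ball n" using q by auto
    have "?E (\<lambda>g. exp (l * F q g)) \<le> exp (l * ?E (F q) + l\<^sup>2 * (\<Sum>x\<in>?A. \<bar>c q x\<bar>\<^sup>2) / 8)"
    proof (rule mcdiarmid_mgf)
      fix x g y y' assume x: "x \<in> ?A"
      show "\<bar>F q (g(x := y)) - F q (g(x := y'))\<bar> \<le> \<bar>c q x\<bar>"
        unfolding F_def using x W1[OF x, of y y']
        by (subst weighted_sum_update) (auto simp: abs_mult intro: mult_left_le)
    qed (use fin l in auto)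
    also have "?E (F q) = (\<Sum>x\<in>?A. c q x * ?E (\<lambda>g. W x (g x)))"
      unfolding F_def by (subst Bochner_Integration.integral_sum) (auto intro!: int)
    also have "\<dots> = 0"
      by (intro sum.neutral ballI) (subst expectation_Pi_pmf_component, auto simp: W0)
    also have "(\<Sum>x\<in>?A. \<bar>c q x\<bar>\<^sup>2) =
        (\<Sum>i<m. (real_of_int (z i))\<^sup>2) * (\<Sum>j<n. (real_of_int (w j))\<^sup>2) / (real m * real n)"
      unfolding sum_product sum_divide_distrib sum.cartesian_product
      by (intro sum.cong) (auto simp: c_def zw power_divide power_mult_distrib)
    also have "\<dots> \<le> (4 * real m) * (4 * real n) / (real m * real n)"
      by (intro divide_right_mono mult_mono lattice_ball_norm zw sum_nonneg) auto
    also have "\<dots> = 16" using mn by simp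
    finally show ?thesis by (simp add: mult_left_mono)
  qed
  have card: "real (card ?L) \<le> exp (6 * l\<^sup>2)"
  proof -
    have "real (card ?L) \<le> exp (6 * real m) * exp (6 * real n)"
      by (simp add: card_cartesian_product mult_mono lattice_ball_card)
    then show ?thesis by (simp add: exp_add[symmetric] l algebra_simps)
  qed
  have "?E (\<lambda>g. exp (l * ?N g)) \<le> ?E (\<lambda>g. \<Sum>q\<in>?L. exp (l * F q g))"
  proof (rule integral_mono[OF int int])
    fix g
    obtain z w where zw: "z \<in> lattice_ball m" "w \<in> lattice_ball n" and "?N g =
      (\<Sum>(i, j)\<in>?A. real_of_int (z i) * real_of_int (w j) / sqrt (real m * real n) * W (i, j) (g (i, j)))"
      by (rule net_norm_attained[of m n "\<lambda>x. W x (g x)"])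
    note this(3)
    also have "\<dots> = F (z, w) g" unfolding F_def by (intro sum.cong) (auto simp: c_def)
    finally have N: "?N g = F (z, w) g" .
    have "(z, w) \<in> ?L" using zw by simp
    then show "exp (l * ?N g) \<le> (\<Sum>q\<in>?L. exp (l * F q g))"
      unfolding N by (rule member_le_sum) (use lattice_ball_card(1) in auto)
  qed
  also have "\<dots> = (\<Sum>q\<in>?L. ?E (\<lambda>g. exp (l * F q g)))"
    by (rule Bochner_Integration.integral_sum) (rule int)
  also have "\<dots> \<le> real (card ?L) * exp (2 * l\<^sup>2)" by (rule sum_bounded_above) (rule mgf)
  also have "\<dots> \<le> exp (6 * l\<^sup>2) * exp (2 * l\<^sup>2)" using card by (rule mult_right_mono) simp
  also have "\<dots> = exp (8 * l\<^sup>2)" by (simp add: exp_add[symmetric])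
  finally have mgf_N: "?E (\<lambda>g. exp (l * ?N g)) \<le> exp (8 * l\<^sup>2)" .
  \<comment> \<open>In place of Jensen's inequality, \<open>1 + x \<le> exp x\<close> is averaged at
    \<open>x = l * ?N g - 8 * l^2\<close>.\<close>
  have "1 + (l * ?E ?N - 8 * l\<^sup>2) = ?E (\<lambda>g. 1 + (l * ?N g - 8 * l\<^sup>2))"
    by (simp add: int)
  also have "\<dots> \<le> ?E (\<lambda>g. exp (- 8 * l\<^sup>2) * exp (l * ?N g))"
  proof (rule integral_mono[OF int int])
    show "1 + (l * ?N g - 8 * l\<^sup>2) \<le> exp (- 8 * l\<^sup>2) * exp (l * ?N g)" for g
      using exp_ge_add_one_self[of "l * ?N g - 8 * l\<^sup>2"] by (simp add: exp_add[symmetric])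
  qed
  also have "\<dots> = exp (- 8 * l\<^sup>2) * ?E (\<lambda>g. exp (l * ?N g))" by simp
  also have "\<dots> \<le> exp (- 8 * l\<^sup>2) * exp (8 * l\<^sup>2)" using mgf_N by (intro mult_left_mono) auto
  also have "\<dots> = 1" by (simp add: exp_add[symmetric])
  finally have "l * ?E ?N \<le> l * (8 * l)" by (simp add: power2_eq_square)
  then show ?thesis using l(1) by (simp add: l_def)
qed

section \<open>The estimator\<close>

definition noise :: "real mat \<Rightarrow> real \<Rightarrow> nat \<times> nat \<Rightarrow> bool \<times> bool \<Rightarrow> real" where
  "noise M \<rho> x y = of_bool (snd y) - (1 - \<rho>) * M $$ x"

lemma expectation_entry_pmf:
  fixes h :: "bool \<times> bool \<Rightarrow> real"
  assumes "0 \<le> p" "p \<le> 1" "0 \<le> \<rho>" "\<rho> \<le> 1"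
  shows "measure_pmf.expectation (entry_pmf p \<rho>) h =
    p * ((1 - \<rho>) * h (True, True) + \<rho> * h (True, False)) + (1 - p) * h (False, False)"
proof -
  have inner: "measure_pmf.expectation (bernoulli_pmf (1 - \<rho>) \<bind> (\<lambda>a. return_pmf (True, a))) h =
      (1 - \<rho>) * h (True, True) + \<rho> * h (True, False)"
    using assms by (subst pmf_expectation_bind[where A = UNIV]) (auto simp: UNIV_bool)
  show ?thesis unfolding entry_pmf_def
    using assms by (subst pmf_expectation_bind[where A = UNIV]) (auto simp: UNIV_bool inner bind_return_pmf)
qed

lemma expectation_noise:
  assumes "0 \<le> M $$ x" "M $$ x \<le> 1" "0 \<le> \<rho>" "\<rho> < 1"
  shows "measure_pmf.expectation (entry_pmf (M $$ x) \<rho>) (noise M \<rho> x) = 0"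
  using assms by (simp add: expectation_entry_pmf noise_def algebra_simps)

lemma shiftmc_basic_inequality:
  assumes "\<rho> < 1" and min: "shiftmc_minimizer m n t \<rho> (\<lambda>x. snd (\<omega> x)) X" and M: "shiftmc_feasible m n t M"
  shows "(\<Sum>i<m. \<Sum>j<n. (M $$ (i, j) - X $$ (i, j))\<^sup>2) \<le>
    2 / (1 - \<rho>) * (\<Sum>x\<in>{..<m} \<times> {..<n}. (X $$ x - M $$ x) * noise M \<rho> x (\<omega> x))"
proof -
  let ?l = "\<lambda>X i j. shifted_loss \<rho> (X $$ (i, j)) (snd (\<omega> (i, j)))"
  \<comment> \<open>The quadratic part is the same for both values of \<open>a\<close>; this makes
    the pointwise identity below exact, so minimality is the only source of inequality.\<close>
  have loss: "shifted_loss \<rho> x a = x\<^sup>2 - (2 * x - 1) * of_bool a / (1 - \<rho>)" for x a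
    using \<open>\<rho> < 1\<close> by (simp add: shifted_loss_def power2_eq_square field_simps)
  have cancel: "2 / (1 - \<rho>) * (d * (a - (1 - \<rho>) * b)) = 2 * d * a / (1 - \<rho>) - 2 * d * b" for d a b
    using \<open>\<rho> < 1\<close> by (simp add: field_simps)
  have pointwise: "(M $$ (i, j) - X $$ (i, j))\<^sup>2 =
      2 / (1 - \<rho>) * ((X $$ (i, j) - M $$ (i, j)) * noise M \<rho> (i, j) (\<omega> (i, j))) + (?l X i j - ?l M i j)" for i j
    unfolding loss noise_def cancel snd_conv by (simp add: power2_eq_square algebra_simps diff_divide_distrib add_divide_distrib)
  have "(\<Sum>i<m. \<Sum>j<n. (M $$ (i, j) - X $$ (i, j))\<^sup>2) =
      2 / (1 - \<rho>) * (\<Sum>i<m. \<Sum>j<n. (X $$ (i, j) - M $$ (i, j)) * noise M \<rho> (i, j) (\<omega> (i, j))) +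
      ((\<Sum>i<m. \<Sum>j<n. ?l X i j) - (\<Sum>i<m. \<Sum>j<n. ?l M i j))"
    unfolding pointwise by (simp add: sum.distrib sum_subtractf sum_distrib_left)
  also have "(\<Sum>i<m. \<Sum>j<n. ?l X i j) \<le> (\<Sum>i<m. \<Sum>j<n. ?l M i j)"
    using min M by (simp add: shiftmc_minimizer_def shiftmc_objective_def)
  also have "(\<Sum>i<m. \<Sum>j<n. (X $$ (i, j) - M $$ (i, j)) * noise M \<rho> (i, j) (\<omega> (i, j))) =
    (\<Sum>x\<in>{..<m} \<times> {..<n}. (X $$ x - M $$ x) * noise M \<rho> x (\<omega> x))"
    by (simp add: sum.cartesian_product split_def)
  finally show ?thesis by simp
qed

text \<open>Duality is applied to \<open>X\<close> with \<open>B\<close> and to \<open>M\<close>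
  with \<open>- B\<close> separately, which avoids the triangle inequality for the nuclear norm.
  Replacing \<open>u\<close> by \<open>- u\<close> shows that \<open>net_norm\<close> of
  \<open>B\<close> also dominates the forms of \<open>- B\<close>.\<close>

lemma inner_product_le_net_norm:
  assumes mn: "0 < m" "0 < n" and X: "shiftmc_feasible m n t X" and M: "shiftmc_feasible m n t M"
  shows "(\<Sum>x\<in>{..<m} \<times> {..<n}. (X $$ x - M $$ x) * B x) \<le> 2 * t * net_norm m n B"
proof -
  have c: "X \<in> carrier_mat m n" "M \<in> carrier_mat m n" and t: "nuclear_norm X \<le> t" "nuclear_norm M \<le> t"
    using X M by (simp_all add: shiftmc_feasible_def)
  have neg: "ip m u (lin n (\<lambda>i j. - B (i, j)) v) \<le> net_norm m n B" if "ip m u u \<le> 1" "ip n v v \<le> 1" for u v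
  proof -
    have "ip m (\<lambda>i. - u i) (lin n (\<lambda>i j. B (i, j)) v) \<le> net_norm m n B"
      by (rule bilinear_le_net_norm) (use mn that in \<open>simp_all add: ip_def\<close>)
    then show ?thesis by (simp add: ip_lin_right)
  qed
  have "(\<Sum>x\<in>{..<m} \<times> {..<n}. (X $$ x - M $$ x) * B x) =
      (\<Sum>i<m. \<Sum>j<n. X $$ (i, j) * B (i, j)) + (\<Sum>i<m. \<Sum>j<n. M $$ (i, j) * - B (i, j))"
    by (simp add: sum.cartesian_product split_def sum.distrib[symmetric] algebra_simps)
  also have "\<dots> \<le> net_norm m n B * nuclear_norm X + net_norm m n B * nuclear_norm M"
    by (intro add_mono nuclear_norm_duality c bilinear_le_net_norm mn neg)
  also have "\<dots> \<le> net_norm m n B * t + net_norm m n B * t"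
    by (intro add_mono mult_left_mono t net_norm_nonneg mn)
  finally show ?thesis by simp
qed

text \<open>The minimizer depends on the noise, so the bound has to hold for all feasible matrices
  at once; concentration is therefore applied to their supremum \<open>f\<close>.\<close>

lemma feasible_noise_tail:
  assumes mn: "0 < m" "0 < n" and Mf: "shiftmc_feasible m n t M"
    and \<rho>: "0 \<le> \<rho>" "\<rho> < 1" and \<delta>: "0 < \<delta>" "\<delta> < 1"
  shows "1 - \<delta> \<le> measure_pmf.prob (obs_pmf m n M \<rho>)
    {\<omega>. \<forall>X. shiftmc_feasible m n t X \<longrightarrow>
      (\<Sum>x\<in>{..<m} \<times> {..<n}. (X $$ x - M $$ x) * noise M \<rho> x (\<omega> x))
        \<le> 16 * t * (sqrt (real m) + sqrt (real n)) + sqrt (real m * real n) * sqrt (ln (2 / \<delta>))}"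
proof -
  let ?A = "{..<m} \<times> {..<n}"
  let ?p = "\<lambda>x. entry_pmf (M $$ x) \<rho>"
  let ?P = "Pi_pmf ?A (False, False) ?p"
  let ?E = "measure_pmf.expectation ?P"
  have obs: "obs_pmf m n M \<rho> = ?P" by (simp add: obs_pmf_def split_def)
  have M01: "\<forall>i<m. \<forall>j<n. 0 \<le> M $$ (i, j) \<and> M $$ (i, j) \<le> 1" using Mf by (simp add: shiftmc_feasible_def)
  have t: "0 \<le> t" using nuclear_norm_nonneg[of M m n] Mf by (simp add: shiftmc_feasible_def)
  define W where "W = noise M \<rho>"
  have W1: "\<bar>W x y - W x y'\<bar> \<le> 1" for x y y' by (simp add: W_def noise_def)
  have W_abs: "\<bar>W x y\<bar> \<le> 1" if "x \<in> ?A" for x y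
  proof -
    have "0 \<le> M $$ x" "M $$ x \<le> 1" using M01 that by auto
    then have "0 \<le> (1 - \<rho>) * M $$ x" "(1 - \<rho>) * M $$ x \<le> 1" using \<rho> by (auto intro: mult_le_one)
    then show ?thesis by (auto simp: W_def noise_def)
  qed
  have W0: "measure_pmf.expectation (?p x) (W x) = 0" if "x \<in> ?A" for x
    unfolding W_def by (rule expectation_noise) (use M01 that \<rho> in auto)
  have fin: "finite (set_pmf (?p x))" for x by simp
  have finP: "finite (set_pmf ?P)" by (rule finite_set_Pi_pmf) auto
  define G where "G = (\<lambda>X \<omega>. \<Sum>x\<in>?A. (X $$ x - M $$ x) * W x (\<omega> x))"
  define F where "F = {X. shiftmc_feasible m n t X}"
  define f where "f = (\<lambda>\<omega>. SUP X\<in>F. G X \<omega>)"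
  have MF: "F \<noteq> {}" using Mf by (auto simp: F_def)
  have D1: "\<bar>X $$ x - M $$ x\<bar> \<le> 1" if "X \<in> F" "x \<in> ?A" for X x
  proof -
    have "0 \<le> X $$ x" "X $$ x \<le> 1" "0 \<le> M $$ x" "M $$ x \<le> 1"
      using that M01 by (auto simp: F_def shiftmc_feasible_def)
    then show ?thesis by linarith
  qed
  \<comment> \<open>The supremum ranges over an infinite set, so it is meaningful only once
    boundedness is known.\<close>
  have "G X \<omega> \<le> (\<Sum>x\<in>?A. 1)" if "X \<in> F" for X \<omega>
    unfolding G_def
  proof (rule sum_mono)
    fix x assume "x \<in> ?A"
    then have "\<bar>(X $$ x - M $$ x) * W x (\<omega> x)\<bar> \<le> 1"
      using D1[OF that] W_abs by (simp add: abs_mult mult_le_one)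
    then show "(X $$ x - M $$ x) * W x (\<omega> x) \<le> 1" by linarith
  qed
  then have bdd: "bdd_above ((\<lambda>X. G X \<omega>) ` F)" for \<omega> by (meson bdd_aboveI2)
  have f_ge: "G X \<omega> \<le> f \<omega>" if "X \<in> F" for X \<omega>
    unfolding f_def by (rule cSUP_upper[OF that bdd])
  have f_upd: "f (g(x := y)) \<le> f (g(x := y')) + 1" if x: "x \<in> ?A" for g x y y'
  proof (subst f_def, rule cSUP_least[OF MF])
    fix X assume X: "X \<in> F"
    have "G X (g(x := y)) - G X (g(x := y')) = (X $$ x - M $$ x) * (W x y - W x y')"
      unfolding G_def by (rule weighted_sum_update) (use x in auto)
    also have "\<dots> \<le> \<bar>(X $$ x - M $$ x) * (W x y - W x y')\<bar>" by simp
    also have "\<dots> \<le> 1" using D1[OF X x] W1 by (simp add: abs_mult mult_le_one)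
    finally show "G X (g(x := y)) \<le> f (g(x := y')) + 1" using f_ge[OF X, of "g(x := y')"] by linarith
  qed
  have "?E f \<le> ?E (\<lambda>\<omega>. 2 * t * net_norm m n (\<lambda>x. W x (\<omega> x)))"
  proof (rule integral_mono)
    fix \<omega>
    show "f \<omega> \<le> 2 * t * net_norm m n (\<lambda>x. W x (\<omega> x))"
      unfolding f_def G_def
      by (rule cSUP_least[OF MF]) (rule inner_product_le_net_norm, use mn Mf in \<open>simp_all add: F_def\<close>)
  qed (auto intro!: integrable_measure_pmf_finite finP)
  also have "\<dots> = 2 * t * ?E (\<lambda>\<omega>. net_norm m n (\<lambda>x. W x (\<omega> x)))" by simp
  also have "\<dots> \<le> 2 * t * (8 * sqrt (real m + real n))"
    using t by (intro mult_left_mono expectation_net_norm mn W0 W1 fin) auto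
  also have "\<dots> \<le> 2 * t * (8 * (sqrt (real m) + sqrt (real n)))"
    using t by (intro mult_left_mono sqrt_add_le_add_sqrt) auto
  finally have Ef: "?E f \<le> 16 * t * (sqrt (real m) + sqrt (real n))" by (simp add: algebra_simps)
  \<comment> \<open>McDiarmid's exponent becomes \<open>2 * ln (2 / \<delta>)\<close>, so the tail
    is at most \<open>(\<delta> / 2)^2\<close>, well below \<open>\<delta>\<close>.\<close>
  define \<epsilon> where "\<epsilon> = sqrt (real m * real n) * sqrt (ln (2 / \<delta>))"
  have ln: "0 < ln (2 / \<delta>)" using \<delta> by (intro ln_gt_zero) simp
  then have \<epsilon>: "0 < \<epsilon>" using mn by (simp add: \<epsilon>_def)
  have "measure_pmf.prob ?P {\<omega>. ?E f + \<epsilon> \<le> f \<omega>} \<le> exp (- 2 * \<epsilon>\<^sup>2 / (\<Sum>x\<in>?A. 1\<^sup>2))"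
  proof (rule mcdiarmid)
    show "\<bar>f (g(x := y)) - f (g(x := y'))\<bar> \<le> 1" if "x \<in> ?A" for x g y y'
      using f_upd[OF that, of g y y'] f_upd[OF that, of g y' y] by linarith
  qed (use mn fin \<epsilon> in auto)
  also have "- 2 * \<epsilon>\<^sup>2 / (\<Sum>x\<in>?A. 1\<^sup>2) = - (2 * ln (2 / \<delta>))"
    using mn ln by (simp add: \<epsilon>_def power_mult_distrib)
  also have "exp (- (2 * ln (2 / \<delta>))) \<le> exp (- ln (2 / \<delta>))" using ln by simp
  also have "\<dots> = \<delta> / 2" using \<delta> by (simp add: exp_minus)
  finally have bad: "measure_pmf.prob ?P {\<omega>. ?E f + \<epsilon> \<le> f \<omega>} \<le> \<delta>" using \<delta> by linarith
  have "1 - \<delta> \<le> 1 - measure_pmf.prob ?P {\<omega>. ?E f + \<epsilon> \<le> f \<omega>}" using bad by simp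
  also have "\<dots> = measure_pmf.prob ?P (- {\<omega>. ?E f + \<epsilon> \<le> f \<omega>})"
    by (subst measure_pmf.prob_compl[symmetric]) (auto simp: Compl_eq_Diff_UNIV)
  also have "\<dots> \<le> measure_pmf.prob ?P
      {\<omega>. \<forall>X. shiftmc_feasible m n t X \<longrightarrow> G X \<omega> \<le> 16 * t * (sqrt (real m) + sqrt (real n)) + \<epsilon>}"
  proof (intro measure_pmf.finite_measure_mono subsetI CollectI allI impI)
    fix \<omega> X
    assume "\<omega> \<in> - {\<omega>. ?E f + \<epsilon> \<le> f \<omega>}" "shiftmc_feasible m n t X"
    then have "f \<omega> < ?E f + \<epsilon>" "G X \<omega> \<le> f \<omega>" using f_ge by (auto simp: F_def)
    then show "G X \<omega> \<le> 16 * t * (sqrt (real m) + sqrt (real n)) + \<epsilon>" using Ef by linarith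
  qed simp
  finally show ?thesis unfolding obs G_def W_def \<epsilon>_def .
qed

text \<open>Deterministic on the good event: dividing by \<open>m n\<close> turns
  \<open>sqrt (m n)\<close> into \<open>1 / sqrt (m n)\<close>. Then the factor 2 is relaxed to 6
  and \<open>r\<close>, later the fourth root of \<open>s\<close>, is added; both enlarge the
  bound.\<close>

lemma shiftmc_error_bound:
  assumes mn: "0 < m" "0 < n" and Mf: "shiftmc_feasible m n t M" and \<rho>: "\<rho> < 1"
    and \<delta>: "0 < \<delta>" "\<delta> < 1" and r: "0 \<le> r"
    and min: "shiftmc_minimizer m n t \<rho> (\<lambda>ij. snd (\<omega> ij)) X"
    and noise: "(\<Sum>x\<in>{..<m} \<times> {..<n}. (X $$ x - M $$ x) * noise M \<rho> x (\<omega> x))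
      \<le> 16 * t * (sqrt (real m) + sqrt (real n)) + sqrt (real m * real n) * sqrt (ln (2 / \<delta>))"
  shows "1 / (real m * real n) * (\<Sum>i<m. \<Sum>j<n. (M $$ (i, j) - X $$ (i, j))\<^sup>2)
    \<le> 6 * sqrt (ln (2 / \<delta>)) / (sqrt (real m * real n) * (1 - \<rho>))
      + 2 * 16 * t * (sqrt (real n) + sqrt (real m) + r) / ((1 - \<rho>) * real m * real n)"
proof -
  let ?G = "\<Sum>x\<in>{..<m} \<times> {..<n}. (X $$ x - M $$ x) * noise M \<rho> x (\<omega> x)"
  let ?e = "sqrt (real m * real n) * sqrt (ln (2 / \<delta>))"
  have t: "0 \<le> t" using nuclear_norm_nonneg[of M m n] Mf by (simp add: shiftmc_feasible_def)
  have ln: "0 < ln (2 / \<delta>)" using \<delta> by (intro ln_gt_zero) simp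
  from noise have "2 / (1 - \<rho>) * ?G \<le> 2 / (1 - \<rho>) * (16 * t * (sqrt (real m) + sqrt (real n)) + ?e)"
    using \<rho> by (intro mult_left_mono) auto
  with shiftmc_basic_inequality[OF \<rho> min Mf]
  have "(\<Sum>i<m. \<Sum>j<n. (M $$ (i, j) - X $$ (i, j))\<^sup>2) \<le>
      2 / (1 - \<rho>) * (16 * t * (sqrt (real m) + sqrt (real n)) + ?e)"
    by linarith
  then have le: "1 / (real m * real n) * (\<Sum>i<m. \<Sum>j<n. (M $$ (i, j) - X $$ (i, j))\<^sup>2) \<le>
      1 / (real m * real n) * (2 / (1 - \<rho>) * (16 * t * (sqrt (real m) + sqrt (real n)) + ?e))"
    by (intro mult_left_mono) auto
  have split: "1 / (a * b) * (2 / q * (16 * t * (x + y) + e)) = 2 * (e / (a * b)) / q + 2 * 16 * t * (y + x) / (q * a * b)"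
    for a b q x y e :: real by (simp add: divide_inverse algebra_simps)
  note le
  also have "1 / (real m * real n) * (2 / (1 - \<rho>) * (16 * t * (sqrt (real m) + sqrt (real n)) + ?e)) =
      2 * (?e / (real m * real n)) / (1 - \<rho>) +
      2 * 16 * t * (sqrt (real n) + sqrt (real m)) / ((1 - \<rho>) * real m * real n)"
    by (rule split)
  also have "?e / (real m * real n) = sqrt (ln (2 / \<delta>)) / sqrt (real m * real n)"
    using sqrt_divide_self_eq[of "real m * real n"] by (simp add: divide_inverse mult_ac)
  also have "2 * (sqrt (ln (2 / \<delta>)) / sqrt (real m * real n)) / (1 - \<rho>) +
      2 * 16 * t * (sqrt (real n) + sqrt (real m)) / ((1 - \<rho>) * real m * real n) \<le>
      6 * sqrt (ln (2 / \<delta>)) / (sqrt (real m * real n) * (1 - \<rho>)) +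
      2 * 16 * t * (sqrt (real n) + sqrt (real m) + r) / ((1 - \<rho>) * real m * real n)"
  proof (rule add_mono)
    show "2 * (sqrt (ln (2 / \<delta>)) / sqrt (real m * real n)) / (1 - \<rho>) \<le>
        6 * sqrt (ln (2 / \<delta>)) / (sqrt (real m * real n) * (1 - \<rho>))"
      using \<rho> ln by (simp add: divide_right_mono)
  qed (use t \<rho> r in \<open>intro divide_right_mono mult_left_mono, auto\<close>)
  finally show ?thesis .
qed

theorem theorem4:
  shows "\<exists>C::real. \<forall>(m::nat) (n::nat) (M::real mat) (t::real) (\<rho>::real) (\<delta>::real).
    0 < m \<longrightarrow> 0 < n \<longrightarrow> M \<in> carrier_mat m n \<longrightarrow>
    (\<forall>i<m. \<forall>j<n. 0 \<le> M $$ (i, j) \<and> M $$ (i, j) \<le> 1) \<longrightarrow>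
    nuclear_norm M \<le> t \<longrightarrow> 0 \<le> \<rho> \<longrightarrow> \<rho> < 1 \<longrightarrow> 0 < \<delta> \<longrightarrow> \<delta> < 1 \<longrightarrow>
    measure_pmf.prob (obs_pmf m n M \<rho>)
      {\<omega>. let s = card {(i, j). i < m \<and> j < n \<and> fst (\<omega> (i, j))};
              A = (\<lambda>ij. snd (\<omega> ij))
          in \<forall>Xh. shiftmc_minimizer m n t \<rho> A Xh \<longrightarrow>
             (1 / (real m * real n)) * (\<Sum>i<m. \<Sum>j<n. (M $$ (i, j) - Xh $$ (i, j))\<^sup>2)
               \<le> 6 * sqrt (ln (2 / \<delta>)) / (sqrt (real m * real n) * (1 - \<rho>))
                 + 2 * C * t * (sqrt (real n) + sqrt (real m) + root 4 (real s))
                   / ((1 - \<rho>) * real m * real n)}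
      \<ge> 1 - \<delta>"
proof (intro exI[of _ 16] allI impI)
  \<comment> \<open>The constant 16 is 8 from the expected norm times 2 from pairing with both
    \<open>X\<close> and \<open>M\<close>; the further factor 2 in the bound comes from
    \<open>2 / (1 - \<rho>)\<close> in the basic inequality.\<close>
  fix m n :: nat and M :: "real mat" and t \<rho> \<delta> :: real
  assume mn: "0 < m" "0 < n" and M: "M \<in> carrier_mat m n"
    "\<forall>i<m. \<forall>j<n. 0 \<le> M $$ (i, j) \<and> M $$ (i, j) \<le> 1" "nuclear_norm M \<le> t"
    and \<rho>: "0 \<le> \<rho>" "\<rho> < 1" and \<delta>: "0 < \<delta>" "\<delta> < 1"
  from M have Mf: "shiftmc_feasible m n t M" by (simp add: shiftmc_feasible_def)
  show "1 - \<delta> \<le> measure_pmf.prob (obs_pmf m n M \<rho>)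
      {\<omega>. let s = card {(i, j). i < m \<and> j < n \<and> fst (\<omega> (i, j))};
              A = (\<lambda>ij. snd (\<omega> ij))
          in \<forall>Xh. shiftmc_minimizer m n t \<rho> A Xh \<longrightarrow>
             (1 / (real m * real n)) * (\<Sum>i<m. \<Sum>j<n. (M $$ (i, j) - Xh $$ (i, j))\<^sup>2)
               \<le> 6 * sqrt (ln (2 / \<delta>)) / (sqrt (real m * real n) * (1 - \<rho>))
                 + 2 * 16 * t * (sqrt (real n) + sqrt (real m) + root 4 (real s))
                   / ((1 - \<rho>) * real m * real n)}"
    unfolding Let_def
  proof (rule order_trans[OF feasible_noise_tail[OF mn Mf \<rho> \<delta>]],
      intro measure_pmf.finite_measure_mono subsetI CollectI allI impI)
    fix \<omega> X
    assume "\<omega> \<in> {\<omega>. \<forall>X. shiftmc_feasible m n t X \<longrightarrow>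
        (\<Sum>x\<in>{..<m} \<times> {..<n}. (X $$ x - M $$ x) * noise M \<rho> x (\<omega> x))
          \<le> 16 * t * (sqrt (real m) + sqrt (real n)) + sqrt (real m * real n) * sqrt (ln (2 / \<delta>))}"
      and min: "shiftmc_minimizer m n t \<rho> (\<lambda>ij. snd (\<omega> ij)) X"
    then have "(\<Sum>x\<in>{..<m} \<times> {..<n}. (X $$ x - M $$ x) * noise M \<rho> x (\<omega> x))
        \<le> 16 * t * (sqrt (real m) + sqrt (real n)) + sqrt (real m * real n) * sqrt (ln (2 / \<delta>))"
      by (simp add: shiftmc_minimizer_def)
    then show "1 / (real m * real n) * (\<Sum>i<m. \<Sum>j<n. (M $$ (i, j) - X $$ (i, j))\<^sup>2)
        \<le> 6 * sqrt (ln (2 / \<delta>)) / (sqrt (real m * real n) * (1 - \<rho>))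
          + 2 * 16 * t * (sqrt (real n) + sqrt (real m) +
              root 4 (real (card {(i, j). i < m \<and> j < n \<and> fst (\<omega> (i, j))}))) / ((1 - \<rho>) * real m * real n)"
      by (intro shiftmc_error_bound[OF mn Mf \<rho>(2) \<delta> _ min]) simp_all
  qed simp
qed

end
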